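(* Consider the parametric barrier problem $(\mathcal P_\mu^\theta)$ associated with the parametric optimization problem $(\mathcal P^\theta)$. Assume that 1. the problem is zero-convex; 2. the problem is path-stable with respect to the interior point method; 3. for every $\theta\in[0,1]$ the set of feasible interior points is path-connected. Then for any $\mu>0$ and any $\theta\in[0,1]$ the barrier problem $(\mathcal P_\mu^\theta)$ has at most one solution, and if such a solution exists, it is the global optimum of $(\mathcal P_\mu^\theta)$.
   Context: Let $f:\mathbb R^n\times[0,1]\to\mathbb R$ and $c:\mathbb R^n\times[0,1]\to\mathbb R^k$ be twice continuously differentiable, and let $0\le m\le n$. For $\theta\in[0,1]$ the parametric optimization problem $(\mathcal P^\theta)$ is: minimize $f(x,\theta)$ over $x\in\mathbb R^n$ subject to $c(x,\theta)=0$ and $x_i\ge 0$ for $i\in\{1,\dots,m\}$. For $\mu>0$ the barrier problem $(\mathcal P^\theta_\mu)$ is: minimize $f(x,\theta)-\mu\sum_{i=1}^m\ln x_i$ subject to $c(x,\theta)=0$, $x\in\mathbb R^n$. A point $x$ is a feasible interior point (for $\theta$) if $x_i>0$ for $i\in\{1,\dots,m\}$ and $c(x,\theta)=0$. The Lagrangian is $\mathcal L_\mu(x,\lambda,\theta)=f(x,\theta)-\mu\sum_{i=1}^m\ln x_i+\lambda^Tc(x,\theta)$ with $\lambda\in\mathbb R^k$, and $F_\mu(x,\lambda,\theta)=\big(\nabla_x\mathcal L_\mu(x,\lambda,\theta),\,c(x,\theta)\big)$ is the residual of the first-order system. A solution of $(\mathcal P_\mu^\theta)$ means a solution of $F_\mu(x,\lambda,\theta)=0$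 with $x$ a feasible interior point. Zero-convex: $x\mapsto f(x,0)$ is convex and the constraints $x\mapsto c(x,0)$ are linear (affine). Singular point: a feasible interior point $x$ (with multiplier $\lambda$) is singular if the Jacobian matrix $\partial F_\mu/\partial(x,\lambda)$ is singular at $(x,\lambda,\theta)$. Path-stable with respect to the interior point method: the barrier formulation $(\mathcal P_\mu^\theta)$ admits no singular feasible points for any $\mu>0$ and any $\theta\in[0,1]$, i.e. $\partial F_\mu/\partial(x,\lambda)$ is nonsingular at $(x,\lambda,\theta)$ for all $\mu>0$, $\theta\in[0,1]$, all feasible interior points $x$ and all $\lambda$.
   Formalization: In hypothesis 3, path-connected is taken to include nonempty: the set of feasible interior points is assumed nonempty for every θ in [0,1]; if empty sets are allowed the claim fails (f = -θx₁², c = θx₂ - 1). Dimensions n, k are at least 1. *)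

theory Defs
  imports "HOL-Analysis.Analysis"
begin

text \<open>
  The index types \<open>'n\<close> and \<open>'k\<close> give the dimensions \<open>n\<close> and \<open>k\<close>. The sign-constrained coordinates
  \<open>1, \<dots>, m\<close> are represented by a set \<open>I :: 'n set\<close>; since \<open>'n\<close> carries no order, an arbitrary
  subset (possibly empty, possibly everything) with \<open>m = card I\<close> stands for the first \<open>m\<close> indices
  after relabelling. The parameter \<open>\<theta>\<close> is the second component of the argument of \<open>f\<close> and \<open>c\<close>, and
  only values \<open>\<theta> \<in> {0..1}\<close> are ever relevant.
\<close>

text \<open>
  Derivatives are taken within \<open>S\<close>, so they are one-sided at the boundary. They are uniquely
  determined when \<open>S\<close> is convex with nonempty interior, as for \<open>S = UNIV \<times> {0..1}\<close>.
\<close>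

definition C2_on :: "'a::real_normed_vector set \<Rightarrow> ('a \<Rightarrow> 'b::real_normed_vector) \<Rightarrow> bool" where
  "C2_on S g \<longleftrightarrow>
     (\<exists>(g' :: 'a \<Rightarrow> 'a \<Rightarrow>\<^sub>L 'b) (g'' :: 'a \<Rightarrow> 'a \<Rightarrow>\<^sub>L 'a \<Rightarrow>\<^sub>L 'b).
        (\<forall>p\<in>S. (g has_derivative blinfun_apply (g' p)) (at p within S)) \<and>
        (\<forall>p\<in>S. (g' has_derivative blinfun_apply (g'' p)) (at p within S)) \<and>
        continuous_on S g'')"

definition gradient :: "(real^'n \<Rightarrow> real) \<Rightarrow> real^'n \<Rightarrow> real^'n" where
  "gradient g x = (\<chi> i. frechet_derivative g (at x) (axis i 1))"

definition feasible_interior ::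
  "'n set \<Rightarrow> ((real^'n) \<times> real \<Rightarrow> real^'k) \<Rightarrow> real \<Rightarrow> (real^'n) set" where
  "feasible_interior I c \<theta> = {x. (\<forall>i\<in>I. x $ i > 0) \<and> c (x, \<theta>) = 0}"

definition barrier_objective ::
  "'n set \<Rightarrow> ((real^'n) \<times> real \<Rightarrow> real) \<Rightarrow> real \<Rightarrow> real \<Rightarrow> real^'n \<Rightarrow> real" where
  "barrier_objective I f \<mu> \<theta> x = f (x, \<theta>) - \<mu> * (\<Sum>i\<in>I. ln (x $ i))"

definition lagrangian ::
  "'n set \<Rightarrow> ((real^'n) \<times> real \<Rightarrow> real) \<Rightarrow> ((real^'n) \<times> real \<Rightarrow> real^'k) \<Rightarrow>
    real \<Rightarrow> real^'n \<Rightarrow> real^'k \<Rightarrow> real \<Rightarrow> real" where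
  "lagrangian I f c \<mu> x lam \<theta> = f (x, \<theta>) - \<mu> * (\<Sum>i\<in>I. ln (x $ i)) + lam \<bullet> c (x, \<theta>)"

text \<open>
  Pairs \<open>(x, lam)\<close> are stored as block vectors indexed by the sum type \<open>'n + 'k\<close>, so that the Jacobian
  of the residual with respect to \<open>(x, lam)\<close> is a square matrix.
\<close>

definition block_vec :: "real^'n \<Rightarrow> real^'k \<Rightarrow> real^('n + 'k)" where
  "block_vec x lam = (\<chi> s. case s of Inl i \<Rightarrow> x $ i | Inr j \<Rightarrow> lam $ j)"

definition block_fst :: "real^('n::finite + 'k::finite) \<Rightarrow> real^'n" where
  "block_fst z = (\<chi> i. z $ Inl i)"

definition block_snd :: "real^('n::finite + 'k::finite) \<Rightarrow> real^'k" where
  "block_snd z = (\<chi> j. z $ Inr j)"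

definition residual ::
  "'n set \<Rightarrow> ((real^'n) \<times> real \<Rightarrow> real) \<Rightarrow> ((real^'n) \<times> real \<Rightarrow> real^'k) \<Rightarrow>
    real \<Rightarrow> real^'n \<Rightarrow> real^'k \<Rightarrow> real \<Rightarrow> real^('n + 'k)" where
  "residual I f c \<mu> x lam \<theta> =
     block_vec (gradient (\<lambda>y. lagrangian I f c \<mu> y lam \<theta>) x) (c (x, \<theta>))"

definition residual_jacobian ::
  "'n set \<Rightarrow> ((real^'n) \<times> real \<Rightarrow> real) \<Rightarrow> ((real^'n) \<times> real \<Rightarrow> real^'k) \<Rightarrow>
    real \<Rightarrow> real^'n \<Rightarrow> real^'k \<Rightarrow> real \<Rightarrow> real^('n + 'k)^('n + 'k)" where
  "residual_jacobian I f c \<mu> x lam \<theta> =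
     jacobian (\<lambda>z. residual I f c \<mu> (block_fst z) (block_snd z) \<theta>) (at (block_vec x lam))"

definition barrier_solution ::
  "'n set \<Rightarrow> ((real^'n) \<times> real \<Rightarrow> real) \<Rightarrow> ((real^'n) \<times> real \<Rightarrow> real^'k) \<Rightarrow>
    real \<Rightarrow> real \<Rightarrow> real^'n \<Rightarrow> real^'k \<Rightarrow> bool" where
  "barrier_solution I f c \<mu> \<theta> x lam \<longleftrightarrow>
     x \<in> feasible_interior I c \<theta> \<and> residual I f c \<mu> x lam \<theta> = 0"

definition zero_convex ::
  "((real^'n) \<times> real \<Rightarrow> real) \<Rightarrow> ((real^'n) \<times> real \<Rightarrow> real^'k) \<Rightarrow> bool" where
  "zero_convex f c \<longleftrightarrow>
     convex_on UNIV (\<lambda>x. f (x, 0)) \<and>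
     (\<exists>(A :: real^'n^'k) b. \<forall>x. c (x, 0) = A *v x + b)"

definition singular_point ::
  "'n set \<Rightarrow> ((real^'n) \<times> real \<Rightarrow> real) \<Rightarrow> ((real^'n) \<times> real \<Rightarrow> real^'k) \<Rightarrow>
    real \<Rightarrow> real \<Rightarrow> real^'n \<Rightarrow> real^'k \<Rightarrow> bool" where
  "singular_point I f c \<mu> \<theta> x lam \<longleftrightarrow>
     x \<in> feasible_interior I c \<theta> \<and> \<not> invertible (residual_jacobian I f c \<mu> x lam \<theta>)"

text \<open>The multiplier of a feasible point is arbitrary: \<open>(x, lam)\<close> need not solve the first-order system.\<close>

definition path_stable ::
  "'n set \<Rightarrow> ((real^'n) \<times> real \<Rightarrow> real) \<Rightarrow> ((real^'n) \<times> real \<Rightarrow> real^'k) \<Rightarrow> bool" where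
  "path_stable I f c \<longleftrightarrow>
     (\<forall>\<mu>>0. \<forall>\<theta>\<in>{0..1}. \<forall>x lam. \<not> singular_point I f c \<mu> \<theta> x lam)"

text \<open>
  Path-connected spaces are understood to be nonempty, whereas the library counts the empty set as
  \<^const>\<open>path_connected\<close>. The difference matters: with \<open>n = 2\<close>, \<open>k = 1\<close>, \<open>I = {}\<close>,
  \<open>f (x, \<theta>) = - \<theta> * x\<^sub>1\<^sup>2\<close> and \<open>c (x, \<theta>) = \<theta> * x\<^sub>2 - 1\<close> the feasible set is empty for \<open>\<theta> = 0\<close>, the
  problem is zero-convex and path-stable, and for \<open>\<theta> > 0\<close> the only solution of the first-order
  system is a maximum.
\<close>

definition nonempty_path_connected :: "'a::topological_space set \<Rightarrow> bool" where
  "nonempty_path_connected S \<longleftrightarrow> S \<noteq> {} \<and> path_connected S"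

text \<open>The admissible points are the feasible interior points, the domain of the logarithmic terms.\<close>

definition barrier_global_optimum ::
  "'n set \<Rightarrow> ((real^'n) \<times> real \<Rightarrow> real) \<Rightarrow> ((real^'n) \<times> real \<Rightarrow> real^'k) \<Rightarrow>
    real \<Rightarrow> real \<Rightarrow> real^'n \<Rightarrow> bool" where
  "barrier_global_optimum I f c \<mu> \<theta> x \<longleftrightarrow>
     is_arg_min (barrier_objective I f \<mu> \<theta>) (\<lambda>y. y \<in> feasible_interior I c \<theta>) x"

end

theory Submission
  imports Defs
begin

text \<open>
  The system that decides singularity is the KKT system: with the Hessian \<open>H\<close> of the Lagrangian and
  the Jacobian \<open>A\<close> of the constraints it is the block matrix with rows \<open>(H, A\<^sup>T)\<close> and \<open>(A, 0)\<close>. Path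
  stability says that it never degenerates on the set of all feasible \<open>(x, lam, \<theta>)\<close>, for the given
  \<open>\<mu>\<close>. Three ideas turn this into uniqueness and global optimality.

  Definiteness of \<open>H\<close> on the kernel of \<open>A\<close> is an open condition, and as long as the KKT system is
  nondegenerate so is its failure. Hence it is inherited along connected sets
  (\<open>pos_on_kernel_propagates\<close>). The set of all feasible \<open>(x, \<theta>)\<close> is connected: each slice is, and
  feasible points survive small changes of \<open>\<theta>\<close> because \<open>A\<close> is surjective
  (\<open>connected_family_of_zero_sets\<close>). At \<open>\<theta> = 0\<close> the form \<open>H\<close> is semidefinite by convexity, hence
  definite on the kernel. So \<open>H\<close> is positive definite on the kernel of \<open>A\<close> at every feasible point, for
  every \<open>\<theta>\<close> and every multiplier \<open>lam\<close> (\<open>path_stable_imp_pos_on_kernel\<close>).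

  The multiplier enters \<open>H v v\<close> linearly, through \<open>lam \<bullet> D\<^sup>2c v v\<close>. A quantity that is affine in \<open>lam\<close>
  and always positive is constant, so \<open>D\<^sup>2c v v = 0\<close> for all tangent vectors \<open>v\<close> of the feasible set:
  its second fundamental form vanishes. Such a level set is locally an affine subspace
  (\<open>level_set_locally_affine\<close>), and since it is connected and closed in the convex set
  \<open>{x. \<forall>i\<in>I. 0 < x $ i}\<close>, it is the intersection of this set with one affine subspace
  (\<open>locally_affine_imp_convex\<close>). So although \<open>c\<close> may be nonlinear for \<open>\<theta> > 0\<close>, the feasible interior
  is convex.

  The barrier objective therefore has positive second derivative along every segment of a convex
  feasible set. A solution of the first-order system is stationary along the segments that start in
  it, so it is the strict global minimum (\<open>strict_minimum_on_segment\<close>). Surjectivity of \<open>A\<close>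
  determines the multiplier.
\<close>

section \<open>Definiteness on the kernel of the constraints\<close>

text \<open>
  Injectivity of the block matrix with rows \<open>(H, A\<^sup>T)\<close> and \<open>(A, 0)\<close>. The equation
  \<open>H v + A\<^sup>T w = 0\<close> is tested against all \<open>z\<close>, which avoids adjoints.
\<close>

definition kkt_nondegenerate :: "('a::euclidean_space \<Rightarrow> 'a \<Rightarrow> real) \<Rightarrow> ('a \<Rightarrow>\<^sub>L 'b::euclidean_space) \<Rightarrow> bool" where
  "kkt_nondegenerate H A \<longleftrightarrow>
     (\<forall>v w. A v = 0 \<longrightarrow> (\<forall>z. H v z + w \<bullet> A z = 0) \<longrightarrow> v = 0 \<and> w = 0)"

definition pos_on_kernel :: "('a::euclidean_space \<Rightarrow> 'a \<Rightarrow> real) \<Rightarrow> ('a \<Rightarrow>\<^sub>L 'b::euclidean_space) \<Rightarrow> bool" where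
  "pos_on_kernel H A \<longleftrightarrow> (\<forall>v. A v = 0 \<longrightarrow> v \<noteq> 0 \<longrightarrow> 0 < H v v)"

text \<open>
  A vector \<open>w\<close> orthogonal to the range of \<open>A\<close> would give the null vector \<open>(0, w)\<close>.
\<close>

lemma kkt_nondegenerate_imp_surj:
  assumes "bilinear H" "kkt_nondegenerate H A"
  shows "surj (blinfun_apply A)"
proof (rule ccontr)
  assume "\<not> surj (blinfun_apply A)"
  moreover have "subspace (range (blinfun_apply A))"
    by (simp add: blinfun.bounded_linear_right bounded_linear.linear linear_subspace_image)
  ultimately have "span (range (blinfun_apply A)) \<noteq> UNIV"
    by (metis span_eq_iff)
  then obtain w where "w \<noteq> 0" "\<forall>y\<in>span (range (blinfun_apply A)). w \<bullet> y = 0"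
    using span_not_UNIV_orthogonal by blast
  then have "\<forall>z. H 0 z + w \<bullet> A z = 0"
    using assms(1) by (simp add: bilinear_lzero span_base)
  then show False
    using assms(2) \<open>w \<noteq> 0\<close> unfolding kkt_nondegenerate_def by (metis blinfun.zero_right)
qed

lemma surj_blinfun_right_inverse:
  fixes A :: "'a::euclidean_space \<Rightarrow>\<^sub>L 'b::euclidean_space"
  assumes "surj (blinfun_apply A)"
  obtains R :: "'b \<Rightarrow>\<^sub>L 'a" where "\<And>y. A (R y) = y"
proof -
  have "linear (blinfun_apply A)"
    by (simp add: blinfun.bounded_linear_right bounded_linear.linear)
  then obtain g where "linear g" "blinfun_apply A \<circ> g = id"
    using assms real_vector.linear_surjective_right_inverse by blast
  then show thesis
    by (intro that[of "Blinfun g"])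
      (auto simp: bounded_linear_Blinfun_apply linear_conv_bounded_linear[symmetric] o_def fun_eq_iff)
qed

text \<open>
  A kernel vector \<open>v\<close> with \<open>H v v = 0\<close> minimises the quadratic form on the kernel. By symmetry of \<open>H\<close>
  the functional \<open>H v\<close> then vanishes on the kernel, so it factors through \<open>A\<close>. This yields a
  multiplier \<open>w\<close> with \<open>H v + A\<^sup>T w = 0\<close>, and nondegeneracy forces \<open>v = 0\<close>.
\<close>

lemma semidefinite_nondegenerate_imp_pos_on_kernel:
  fixes A :: "'a::euclidean_space \<Rightarrow>\<^sub>L 'b::euclidean_space"
  assumes bil: "bilinear H" and sym: "\<And>u v. H u v = H v u"
    and nondeg: "kkt_nondegenerate H A"
    and semi: "\<And>v. A v = 0 \<Longrightarrow> 0 \<le> H v v"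
  shows "pos_on_kernel H A"
proof -
  obtain R :: "'b \<Rightarrow>\<^sub>L 'a" where R: "\<And>y. A (R y) = y"
    using surj_blinfun_right_inverse kkt_nondegenerate_imp_surj[OF bil nondeg] by metis
  have "v = 0" if v: "A v = 0" "H v v = 0" for v
  proof -
    have kernel: "H v z = 0" if "A z = 0" for z
    proof -
      have *: "0 \<le> H z z + 2 * t * H v z" for t
      proof -
        have "0 \<le> H (z + t *\<^sub>R v) (z + t *\<^sub>R v)"
          by (rule semi) (simp add: blinfun.bilinear_simps v that)
        also have "\<dots> = H z z + 2 * t * H v z"
          using v sym[of z v] by (simp add: bilinear_ladd[OF bil] bilinear_radd[OF bil] bilinear_lmul[OF bil] bilinear_rmul[OF bil])
        finally show ?thesis .
      qed
      show ?thesis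
      proof (rule ccontr)
        \<comment> \<open>the inequality fails at the \<open>t\<close> for which its right-hand side is \<open>- 1\<close>\<close>
        assume "H v z \<noteq> 0"
        then have "2 * (- (H z z + 1) / (2 * H v z)) * H v z = - (H z z + 1)"
          by simp
        then show False
          using *[of "- (H z z + 1) / (2 * H v z)"] by linarith
      qed
    qed
    have lin: "linear (H v)"
      using bil by (simp add: bilinear_def)
    let ?phi = "\<lambda>y. H v (R y)"
    have linphi: "linear ?phi"
      using linear_compose[OF bounded_linear.linear[OF blinfun.bounded_linear_right[of R]] lin]
      by (simp add: o_def)
    \<comment> \<open>\<open>adjoint ?phi 1\<close> is the vector that represents the functional \<open>?phi\<close>\<close>
    have "H v z + (- adjoint ?phi 1) \<bullet> A z = 0" for z
    proof -
      have "H v (z - R (A z)) = 0"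
        by (rule kernel) (simp add: blinfun.bilinear_simps R)
      then have "H v z = ?phi (A z)"
        by (simp add: linear_diff[OF lin])
      also have "\<dots> = adjoint ?phi 1 \<bullet> A z"
        using adjoint_works[OF linphi, of "A z" 1] by (simp add: inner_commute)
      finally show ?thesis by simp
    qed
    then show ?thesis
      using nondeg v(1) unfolding kkt_nondegenerate_def by blast
  qed
  then show ?thesis
    unfolding pos_on_kernel_def using semi by (metis order_le_less)
qed

text \<open>
  The kernel does not jump at a surjective map. With a right inverse \<open>R\<close> of \<open>A\<close>, the map \<open>B \<circ> R\<close> is close
  to the identity for \<open>B\<close> near \<open>A\<close>, hence bijective, and a small vector in the range of \<open>R\<close> corrects
  \<open>v\<close> to an element of the kernel of \<open>B\<close>.
\<close>

lemma kernel_approximation: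
  fixes A :: "'a::euclidean_space \<Rightarrow>\<^sub>L 'b::euclidean_space"
  assumes "surj (blinfun_apply A)" "A v = 0" "e > 0"
  obtains d where "d > 0" "\<And>B. norm (B - A) < d \<Longrightarrow> \<exists>u. blinfun_apply B u = 0 \<and> norm (u - v) < e"
proof -
  obtain R :: "'b \<Rightarrow>\<^sub>L 'a" where R: "\<And>y. A (R y) = y"
    using surj_blinfun_right_inverse assms(1) by metis
  define K where "K = 1 + norm R"
  have K: "K > 0" unfolding K_def by (simp add: add_pos_nonneg)
  define N where "N = 1 + norm v"
  define d where "d = min (1 / (2 * K)) (e / (2 * K * N))"
  have pv: "N > 0" "norm v \<le> N" unfolding N_def by (simp_all add: add_pos_nonneg)
  have "d > 0" unfolding d_def using K \<open>e > 0\<close> pv by simp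
  moreover have "\<exists>u. blinfun_apply B u = 0 \<and> norm (u - v) < e" if B: "norm (B - A) < d" for B
  proof -
    have near: "norm (B (R y) - y) \<le> norm y / 2" for y
    proof -
      have "B (R y) - y = (B - A) (R y)"
        by (simp add: blinfun.bilinear_simps R)
      also have "norm \<dots> \<le> norm (B - A) * (norm R * norm y)"
        by (meson norm_blinfun mult_left_mono norm_ge_zero order_trans)
      also have "\<dots> \<le> (1 / (2 * K)) * (K * norm y)"
        using B K unfolding d_def K_def by (intro mult_mono mult_right_mono) auto
      also have "\<dots> = norm y / 2" using K by simp
      finally show ?thesis .
    qed
    have half: "norm y \<le> 2 * norm (B (R y))" for y
      using near[of y] norm_triangle_ineq2[of y "B (R y)"] by (simp add: norm_minus_commute)
    have lin: "linear (\<lambda>y. B (R y))"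
      by (rule bounded_linear.linear)
         (intro bounded_linear_compose[OF blinfun.bounded_linear_right blinfun.bounded_linear_right])
    have "inj (\<lambda>y. B (R y))"
      unfolding linear_injective_0[OF lin] using half by (metis mult_zero_right norm_le_zero_iff norm_zero)
    then have "surj (\<lambda>y. B (R y))"
      using lin linear_injective_imp_surjective by blast
    then obtain y where y: "B (R y) = B v" by (metis surjD)
    have "B v = (B - A) v" using assms by (simp add: blinfun.bilinear_simps)
    then have Bv: "norm (B v) \<le> norm (B - A) * norm v" by (metis norm_blinfun)
    have "norm (R y) \<le> norm R * norm y" by (rule norm_blinfun)
    also have "\<dots> \<le> K * (2 * norm (B v))"
      using half[of y] y unfolding K_def by (intro mult_mono) auto
    also have "\<dots> \<le> K * (2 * (norm (B - A) * norm v))"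
      using Bv K by simp
    also have "\<dots> \<le> K * (2 * (norm (B - A) * N))"
      using K pv by (intro mult_left_mono) auto
    also have "\<dots> < K * (2 * (e / (2 * K * N) * N))"
      using B K pv unfolding d_def by (intro mult_strict_left_mono mult_strict_right_mono) auto
    also have "\<dots> = e"
      using K pv by simp
    finally show ?thesis
      by (intro exI[of _ "v - R y"]) (simp add: blinfun.bilinear_simps y)
  qed
  ultimately show thesis using that by blast
qed

text \<open>
  Both the property and its negation are open in \<open>T\<close>. If the property holds at \<open>p\<close> but fails at points
  \<open>q n\<close> converging to \<open>p\<close>, a limit of unit kernel vectors on which the forms are nonpositive
  contradicts it. If it fails at \<open>p\<close>, nondegeneracy provides a kernel vector on which the form is
  strictly negative, and by \<open>kernel_approximation\<close> nearby kernels contain nearby vectors.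
\<close>

lemma pos_on_kernel_propagates:
  fixes H :: "'p::metric_space \<Rightarrow> 'a::euclidean_space \<Rightarrow> 'a \<Rightarrow> real"
    and A :: "'p \<Rightarrow> 'a \<Rightarrow>\<^sub>L 'b::euclidean_space"
  assumes "connected T"
    and contA: "continuous_on T A"
    and contH: "continuous_on (T \<times> UNIV) (\<lambda>(p, v). H p v v)"
    and bil: "\<And>p. p \<in> T \<Longrightarrow> bilinear (H p)"
    and sym: "\<And>p u v. p \<in> T \<Longrightarrow> H p u v = H p v u"
    and nondeg: "\<And>p. p \<in> T \<Longrightarrow> kkt_nondegenerate (H p) (A p)"
    and "a \<in> T" "b \<in> T" "pos_on_kernel (H a) (A a)"
  shows "pos_on_kernel (H b) (A b)"
proof (rule connected_induction_simple[OF \<open>connected T\<close> \<open>a \<in> T\<close> \<open>b \<in> T\<close>,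
      where P = "\<lambda>p. pos_on_kernel (H p) (A p)"])
  show "pos_on_kernel (H a) (A a)" by fact
  fix p assume "p \<in> T"
  show "\<exists>U. openin (top_of_set T) U \<and> p \<in> U \<and>
          (\<forall>x\<in>U. \<forall>y\<in>U. pos_on_kernel (H x) (A x) \<longrightarrow> pos_on_kernel (H y) (A y))"
  proof (cases "pos_on_kernel (H p) (A p)")
    case True
    have "\<exists>d>0. \<forall>q\<in>T \<inter> ball p d. pos_on_kernel (H q) (A q)"
    proof (rule ccontr)
      assume "\<not> ?thesis"
      then have "\<forall>n. \<exists>q. q \<in> T \<inter> ball p (inverse (real (Suc n))) \<and> \<not> pos_on_kernel (H q) (A q)"
        by (metis inverse_positive_iff_positive of_nat_0_less_iff zero_less_Suc)
      then obtain q where q: "\<And>n. q n \<in> T" "\<And>n. dist p (q n) < inverse (real (Suc n))"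
          "\<And>n. \<not> pos_on_kernel (H (q n)) (A (q n))"
        unfolding Int_iff mem_ball by metis
      have qlim: "q \<longlonglongrightarrow> p"
        unfolding tendsto_dist_iff[of q]
      proof (rule Lim_null_comparison[OF always_eventually LIMSEQ_inverse_real_of_nat], rule allI)
        show "norm (dist (q n) p) \<le> inverse (real (Suc n))" for n
          using less_imp_le[OF q(2)[of n]] by (simp only: dist_commute[of p] real_norm_def abs_of_nonneg zero_le_dist)
      qed
      have "\<exists>u. norm u = 1 \<and> A (q n) u = 0 \<and> H (q n) u u \<le> 0" for n
      proof -
        obtain v where v: "A (q n) v = 0" "v \<noteq> 0" "H (q n) v v \<le> 0"
          using q(3)[of n] unfolding pos_on_kernel_def by force
        show ?thesis
          using v bil[OF q(1)[of n]]
          by (intro exI[of _ "inverse (norm v) *\<^sub>R v"])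
             (auto simp: blinfun.bilinear_simps bilinear_lmul bilinear_rmul mult_nonneg_nonpos)
      qed
      then obtain u where u: "\<And>n. norm (u n) = 1" "\<And>n. A (q n) (u n) = 0"
          "\<And>n. H (q n) (u n) (u n) \<le> 0" by metis
      have "\<forall>n. u n \<in> sphere 0 1" using u(1) by simp
      then obtain v r where r: "strict_mono r" and v: "v \<in> sphere 0 1" "(u \<circ> r) \<longlonglongrightarrow> v"
        using compact_sphere unfolding compact_def by blast
      have qr: "(\<lambda>n. q (r n)) \<longlonglongrightarrow> p" and ur: "(\<lambda>n. u (r n)) \<longlonglongrightarrow> v"
        using LIMSEQ_subseq_LIMSEQ[OF qlim r] v(2) by (simp_all add: o_def)
      have "(\<lambda>n. A (q (r n)) (u (r n))) \<longlonglongrightarrow> A p v"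
        by (intro tendsto_intros ur continuous_on_tendsto_compose[OF contA qr])
           (use \<open>p \<in> T\<close> q(1) in auto)
      then have "A p v = 0" using u(2) by (simp add: LIMSEQ_const_iff)
      moreover have "(\<lambda>n. H (q (r n)) (u (r n)) (u (r n))) \<longlonglongrightarrow> H p v v"
        using continuous_on_tendsto_compose[OF contH tendsto_Pair[OF qr ur]] \<open>p \<in> T\<close> q(1) by simp
      then have "H p v v \<le> 0" by (rule LIMSEQ_le_const2) (use u(3) in auto)
      ultimately show False
        using True v(1) unfolding pos_on_kernel_def by force
    qed
    then obtain d where "d > 0" "\<forall>q\<in>T \<inter> ball p d. pos_on_kernel (H q) (A q)" by blast
    then show ?thesis
      using \<open>p \<in> T\<close> by (intro exI[of _ "T \<inter> ball p d"]) (auto simp: openin_open_Int)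
  next
    case False
    obtain v where v: "A p v = 0" "H p v v < 0"
      using False semidefinite_nondegenerate_imp_pos_on_kernel[OF bil sym nondeg, OF \<open>p \<in> T\<close> \<open>p \<in> T\<close> \<open>p \<in> T\<close>]
      by (metis linorder_not_less)
    have "\<exists>e>0. \<forall>x\<in>T \<times> UNIV. dist x (p, v) < e \<longrightarrow> dist (case x of (p, v) \<Rightarrow> H p v v) (H p v v) < - H p v v"
      using contH[unfolded continuous_on_iff, rule_format, of "(p, v)" "- H p v v"] \<open>p \<in> T\<close> v by simp
    then obtain e where e: "e > 0"
      "\<And>q u. q \<in> T \<Longrightarrow> dist (q, u) (p, v) < e \<Longrightarrow> H q u u < 0"
      by (fastforce simp: dist_real_def)
    obtain d where d: "d > 0" "\<And>B. norm (B - A p) < d \<Longrightarrow> \<exists>u. blinfun_apply B u = 0 \<and> norm (u - v) < e / 2"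
      using kernel_approximation[OF kkt_nondegenerate_imp_surj[OF bil nondeg] v(1), OF \<open>p \<in> T\<close> \<open>p \<in> T\<close>, of "e / 2"] e(1) by auto
    obtain d' where d': "d' > 0" "\<And>q. q \<in> T \<Longrightarrow> dist q p < d' \<Longrightarrow> norm (A q - A p) < d"
      using contA[unfolded continuous_on_iff, rule_format, OF \<open>p \<in> T\<close> d(1)] by (auto simp: dist_norm)
    have "\<not> pos_on_kernel (H q) (A q)" if q: "q \<in> T" "dist q p < min d' (e / 2)" for q
    proof -
      obtain u where u: "A q u = 0" "norm (u - v) < e / 2" using d d' q by force
      have "dist (q, u) (p, v) \<le> dist q p + dist u v"
        unfolding dist_Pair_Pair by (rule sqrt_sum_squares_le_sum) auto
      also have "\<dots> < e" using q u by (simp add: dist_norm)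
      finally have neg: "H q u u < 0" using e q by blast
      then have "u \<noteq> 0" using bilinear_lzero[OF bil[OF q(1)]] by auto
      then show ?thesis using neg u unfolding pos_on_kernel_def by force
    qed
    then show ?thesis
      using \<open>p \<in> T\<close> e d'
      by (intro exI[of _ "T \<inter> ball p (min d' (e / 2))"]) (auto simp: openin_open_Int dist_commute)
  qed
qed

section \<open>Zero sets depending on a parameter\<close>

text \<open>
  The dependence on the parameter is merely continuous and the parameter may lie on the boundary of
  \<open>T\<close>, so the zero is found by Brouwer's theorem instead of an implicit function theorem. In the
  coordinates \<open>y \<mapsto> x0 + R y\<close>, with \<open>R\<close> a right inverse of \<open>A\<close>, the map differs from the identity by at
  most half of the radius on a small ball, and a uniformly small perturbation keeps the iteration
  \<open>y \<mapsto> y - c (x0 + R y, t)\<close> inside the ball.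
\<close>

lemma zero_persists:
  fixes c :: "'a::euclidean_space \<times> 'p::metric_space \<Rightarrow> 'b::euclidean_space"
  assumes cont: "continuous_on (UNIV \<times> T) c" and "compact T" and "t0 \<in> T"
    and deriv: "((\<lambda>x. c (x, t0)) has_derivative blinfun_apply A) (at x0)"
    and "surj (blinfun_apply A)" and "c (x0, t0) = 0" and "e > 0"
  obtains d where "d > 0" "\<And>t. \<lbrakk>t \<in> T; dist t t0 < d\<rbrakk> \<Longrightarrow> \<exists>x\<in>ball x0 e. c (x, t) = 0"
proof -
  obtain R :: "'b \<Rightarrow>\<^sub>L 'a" where R: "\<And>y. A (R y) = y"
    using surj_blinfun_right_inverse assms(5) by metis
  define g where "g y t = c (x0 + R y, t)" for y t
  have "((\<lambda>y. g y t0) has_derivative (\<lambda>y. A (R y))) (at 0)"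
    unfolding g_def
    by (rule has_derivative_compose[of "\<lambda>y. x0 + R y"])
       (auto intro!: derivative_eq_intros simp: deriv)
  then have dg: "((\<lambda>y. g y t0) has_derivative (\<lambda>y. y)) (at 0)" by (simp add: R)
  then obtain d1 where d1: "d1 > 0"
      "\<And>y. norm y < d1 \<Longrightarrow> norm (g y t0 - y) \<le> (1/2) * norm y"
    using dg[unfolded has_derivative_at_alt, THEN conjunct2, rule_format, of "1/2"] \<open>c (x0, t0) = 0\<close>
    by (auto simp: g_def blinfun.zero_right)
  define K where "K = norm R + 1"
  define r where "r = min (d1 / 2) (e / (2 * K))"
  have nR: "K > 0" "norm R \<le> K" by (simp_all add: K_def add_nonneg_pos)
  have r: "r > 0" "r < d1" using d1 \<open>e > 0\<close> nR by (auto simp: r_def)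
  have ball: "x0 + R y \<in> ball x0 e" if "norm y \<le> r" for y
  proof -
    have "norm (R y) \<le> norm R * norm y" by (rule norm_blinfun)
    also have "\<dots> \<le> K * r" using that r nR by (intro mult_mono) auto
    also have "\<dots> \<le> K * (e / (2 * K))"
      using nR by (intro mult_left_mono) (auto simp: r_def)
    also have "\<dots> = e / 2" using nR by simp
    finally show ?thesis using \<open>e > 0\<close> by (simp add: dist_norm)
  qed
  have cont_g: "continuous_on (cball 0 r \<times> T) (\<lambda>(y, t). g y t)"
    unfolding g_def case_prod_unfold
    by (rule continuous_on_compose2[OF cont]) (auto intro!: continuous_intros)
  have "uniformly_continuous_on (cball 0 r \<times> T) (\<lambda>(y, t). g y t)"
    using cont_g \<open>compact T\<close> by (intro compact_uniformly_continuous compact_Times) auto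
  then obtain d where d: "d > 0"
    "\<And>p q. \<lbrakk>p \<in> cball 0 r \<times> T; q \<in> cball 0 r \<times> T; dist q p < d\<rbrakk>
      \<Longrightarrow> dist (case q of (y, t) \<Rightarrow> g y t) (case p of (y, t) \<Rightarrow> g y t) < r / 2"
    unfolding uniformly_continuous_on_def using r(1) by (metis half_gt_zero)
  have "\<exists>x\<in>ball x0 e. c (x, t) = 0" if t: "t \<in> T" "dist t t0 < d" for t
  proof -
    have "continuous_on (cball 0 r) (\<lambda>y. g y t)"
      using continuous_on_compose2[OF cont_g, of "cball 0 r" "\<lambda>y. (y, t)"] t(1)
      by (simp add: image_subset_iff continuous_on_Pair)
    then have "continuous_on (cball 0 r) (\<lambda>y. y - g y t)"
      by (intro continuous_intros)
    moreover have "y - g y t \<in> cball 0 r" if y: "y \<in> cball 0 r" for y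
    proof -
      have "dist (y, t) (y, t0) < d" using t(2) by (simp add: dist_Pair_Pair)
      then have "norm (g y t - g y t0) < r / 2"
        using d(2)[of "(y, t0)" "(y, t)"] y t(1) \<open>t0 \<in> T\<close> by (simp add: dist_norm)
      moreover have "norm (g y t0 - y) \<le> r / 2"
        using d1(2)[of y] y r by simp
      moreover have "y - g y t = - ((g y t - g y t0) + (g y t0 - y))" by simp
      ultimately have "norm (y - g y t) \<le> r"
        using norm_triangle_ineq[of "g y t - g y t0" "g y t0 - y"] by (metis norm_minus_cancel add_mono field_sum_of_halves less_imp_le order_trans)
      then show ?thesis by simp
    qed
    ultimately obtain y where y: "y \<in> cball 0 r" "y - g y t = y"
      using brouwer[of "cball (0::'b) r" "\<lambda>y. y - g y t"] r(1) by (auto simp: Pi_iff)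
    then show ?thesis
      using ball[of y] by (intro bexI[of _ "x0 + R y"]) (auto simp: g_def)
  qed
  with d(1) show thesis using that by blast
qed

text \<open>
  By \<open>zero_persists\<close> the projection to the parameter is an open map. Its fibres are connected, and so is
  its image \<open>T\<close>.
\<close>

lemma connected_family_of_zero_sets:
  fixes c :: "'a::euclidean_space \<times> 'p::metric_space \<Rightarrow> 'b::euclidean_space"
  assumes cont: "continuous_on (UNIV \<times> T) c" and "compact T" "connected T" and "open U"
    and deriv: "\<And>x t. \<lbrakk>x \<in> U; t \<in> T; c (x, t) = 0\<rbrakk>
      \<Longrightarrow> ((\<lambda>x. c (x, t)) has_derivative blinfun_apply (c' (x, t))) (at x)"
    and surj: "\<And>x t. \<lbrakk>x \<in> U; t \<in> T; c (x, t) = 0\<rbrakk> \<Longrightarrow> surj (blinfun_apply (c' (x, t)))"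
    and nonempty: "\<And>t. t \<in> T \<Longrightarrow> {x \<in> U. c (x, t) = 0} \<noteq> {}"
    and conn: "\<And>t. t \<in> T \<Longrightarrow> connected {x \<in> U. c (x, t) = 0}"
  shows "connected {p \<in> U \<times> T. c p = 0}" (is "connected ?S")
proof -
  have "connected (?S \<inter> snd -` T)"
  proof (rule connected_open_monotone_preimage[OF _ _ _ _ \<open>connected T\<close> subset_refl])
    show "continuous_on ?S snd" by (intro continuous_intros)
    show "snd ` ?S = T" using nonempty by (force simp: image_iff)
    show "connected (?S \<inter> snd -` {t})" if "t \<in> T" for t
    proof -
      have "?S \<inter> snd -` {t} = (\<lambda>x. (x, t)) ` {x \<in> U. c (x, t) = 0}" using that by auto
      then show ?thesis
        using connected_continuous_image[OF _ conn[OF that], of "\<lambda>x. (x, t)"]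
        by (simp add: continuous_on_Pair)
    qed
    show "openin (top_of_set T) (snd ` V)" if V: "openin (top_of_set ?S) V" for V
      unfolding openin_euclidean_subtopology_iff
    proof (intro conjI ballI)
      have VS: "V \<subseteq> ?S" using V openin_imp_subset by blast
      then show "snd ` V \<subseteq> T" by auto
      fix t assume "t \<in> snd ` V"
      then obtain x where x: "(x, t) \<in> V" by auto
      then have xt: "x \<in> U" "t \<in> T" "c (x, t) = 0" using VS by auto
      obtain e where e: "e > 0" "\<And>q. q \<in> ?S \<Longrightarrow> dist q (x, t) < e \<Longrightarrow> q \<in> V"
        using V x unfolding openin_euclidean_subtopology_iff by blast
      obtain e' where e': "e' > 0" "ball x e' \<subseteq> U"
        using \<open>open U\<close> xt(1) open_contains_ball by blast
      obtain d where d: "d > 0"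
        "\<And>s. \<lbrakk>s \<in> T; dist s t < d\<rbrakk> \<Longrightarrow> \<exists>y\<in>ball x (min (e / 2) e'). c (y, s) = 0"
        using zero_persists[OF cont \<open>compact T\<close> xt(2) deriv[OF xt] surj[OF xt] xt(3), of "min (e / 2) e'"] e(1) e'(1) by auto
      have "s \<in> snd ` V" if s: "s \<in> T" "dist s t < min d (e / 2)" for s
      proof -
        obtain y where y: "y \<in> ball x (min (e / 2) e')" "c (y, s) = 0" using d s by fastforce
        have "dist (y, s) (x, t) \<le> dist y x + dist s t"
          unfolding dist_Pair_Pair by (rule sqrt_sum_squares_le_sum) auto
        also have "\<dots> < e" using y s by (simp add: dist_commute)
        finally have "(y, s) \<in> V" using e' y s by (intro e(2)) auto
        then show ?thesis by force
      qed
      then show "\<exists>d>0. \<forall>s\<in>T. dist s t < d \<longrightarrow> s \<in> snd ` V"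
        using d(1) e(1) by (intro exI[of _ "min d (e / 2)"]) auto
    qed
  qed
  moreover have "?S \<inter> snd -` T = ?S" by auto
  ultimately show ?thesis by simp
qed


section \<open>Level sets without curvature\<close>

text \<open>
  Gronwall's inequality: \<open>(norm (e s))\<^sup>2 * exp (- 2 * C * s)\<close> cannot increase.
\<close>

lemma zero_of_linear_growth:
  fixes e :: "real \<Rightarrow> 'b::real_inner"
  assumes deriv: "\<And>s. s \<in> {0..1} \<Longrightarrow> (e has_vector_derivative e' s) (at s)"
    and growth: "\<And>s. s \<in> {0..1} \<Longrightarrow> norm (e' s) \<le> C * norm (e s)"
    and "e 0 = 0" and s: "s \<in> {0..1}"
  shows "e s = 0"
proof -
  define N where "N = (\<lambda>s. (e s \<bullet> e s) * exp (- 2 * C * s))"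
  have "N s \<le> N 0"
  proof (rule DERIV_nonpos_imp_nonincreasing[where f = N])
    show "0 \<le> s" using s by simp
    fix t assume t: "0 \<le> t" "t \<le> s"
    then have t': "t \<in> {0..1}" using s by simp
    have "((\<lambda>s. e s \<bullet> e s) has_derivative (\<lambda>h. e t \<bullet> (h *\<^sub>R e' t) + (h *\<^sub>R e' t) \<bullet> e t)) (at t)"
      using has_derivative_inner[OF deriv[OF t', unfolded has_vector_derivative_def] deriv[OF t', unfolded has_vector_derivative_def]] .
    then have *: "((\<lambda>s. e s \<bullet> e s) has_real_derivative 2 * (e t \<bullet> e' t)) (at t)"
      unfolding has_field_derivative_def by (rule has_derivative_eq_rhs) (auto simp: inner_commute)
    have "(N has_real_derivative (2 * (e t \<bullet> e' t) - 2 * C * (e t \<bullet> e t)) * exp (- 2 * C * t)) (at t)"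
      unfolding N_def by (rule derivative_eq_intros * refl | simp add: algebra_simps)+
    moreover have "e t \<bullet> e' t \<le> C * (e t \<bullet> e t)"
    proof -
      have "e t \<bullet> e' t \<le> norm (e t) * norm (e' t)" by (rule norm_cauchy_schwarz)
      also have "\<dots> \<le> norm (e t) * (C * norm (e t))" by (intro mult_left_mono growth t') simp
      also have "\<dots> = C * (e t \<bullet> e t)" by (simp add: dot_square_norm power2_eq_square)
      finally show ?thesis .
    qed
    ultimately show "\<exists>y. (N has_real_derivative y) (at t) \<and> y \<le> 0"
      by (intro exI conjI) (auto simp: mult_le_0_iff)
  qed
  then have "(e s \<bullet> e s) * exp (- 2 * C * s) \<le> 0" using \<open>e 0 = 0\<close> by (simp add: N_def)
  then have "e s \<bullet> e s \<le> 0" by (simp add: mult_le_0_iff)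
  then show ?thesis by (metis inner_gt_zero_iff linorder_not_less)
qed

text \<open>
  With a right inverse \<open>R\<close> of \<open>c' x0\<close>, the map
  \<open>Psi x = (x - x0) - R (c' x0 (x - x0)) + R (c x)\<close> straightens the level set. Its derivative at \<open>x0\<close>
  is the identity, and \<open>Psi x\<close> lies in the kernel of \<open>c' x0\<close> exactly when \<open>c x = 0\<close>. For \<open>u\<close> in this
  kernel the curve \<open>y s\<close> with \<open>Psi (y s) = s u\<close> stays in the level set, and the claim is that
  it is the line \<open>x0 + s u\<close>. Its deviation from a straight line is measured by \<open>e s = R (c' (y s) u)\<close>.
  In \<open>e' s = R (c'' (y s) (y' s) u)\<close> one may replace \<open>u\<close> by \<open>u - y' s\<close>, because \<open>c''\<close> vanishes on the
  tangent vector \<open>y' s\<close>, and \<open>u - y' s\<close> is bounded by a multiple of \<open>e s\<close>. So \<open>e\<close> vanishes by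
  \<open>zero_of_linear_growth\<close>.
\<close>

lemma level_set_locally_affine:
  fixes c :: "'a::euclidean_space \<Rightarrow> 'b::euclidean_space"
  assumes "open U"
    and d1: "\<And>x. x \<in> U \<Longrightarrow> (c has_derivative blinfun_apply (c' x)) (at x)"
    and d2: "\<And>x. x \<in> U \<Longrightarrow> (c' has_derivative blinfun_apply (c'' x)) (at x)"
    and cont: "continuous_on U c''"
    and flat: "\<And>x v. \<lbrakk>x \<in> U; c x = 0; c' x v = 0\<rbrakk> \<Longrightarrow> c'' x v v = 0"
    and x0: "x0 \<in> U" "c x0 = 0" "surj (blinfun_apply (c' x0))"
  shows "\<exists>r>0. ball x0 r \<subseteq> U \<and> (\<forall>x\<in>ball x0 r. c x = 0 \<longleftrightarrow> c' x0 (x - x0) = 0)"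
proof -
  obtain R :: "'b \<Rightarrow>\<^sub>L 'a" where R: "\<And>y. c' x0 (R y) = y"
    using surj_blinfun_right_inverse x0(3) by metis
  define Psi where "Psi x = (x - x0) - R (c' x0 (x - x0)) + R (c x)" for x
  define D where "D x = id_blinfun - (R o\<^sub>L c' x0) + (R o\<^sub>L c' x)" for x
  have D_apply: "D x z = z - R (c' x0 z) + R (c' x z)" for x z
    by (simp add: D_def blinfun.bilinear_simps)
  have D_x0: "D x0 = id_blinfun" by (simp add: D_def)
  have c_Psi: "c' x0 (Psi x) = c x" for x
    by (simp add: Psi_def blinfun.bilinear_simps R)
  have c_D: "c' x0 (D x z) = c' x z" for x z
    by (simp add: D_apply blinfun.bilinear_simps R)
  have Psi_x0: "Psi x0 = 0" using x0 by (simp add: Psi_def)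
  have dPsi: "(Psi has_derivative blinfun_apply (D x)) (at x)" if "x \<in> U" for x
    unfolding Psi_def
    by (rule derivative_eq_intros d1[OF that] refl)+ (auto simp: D_apply fun_eq_iff)
  have cont_c': "continuous_on U c'"
    using d2 by (meson continuous_at_imp_continuous_on has_derivative_continuous)
  have contD: "continuous_on U D"
    unfolding D_def by (intro continuous_intros cont_c')
  obtain d1 where d1: "d1 > 0" "\<And>x. x \<in> U \<Longrightarrow> dist x x0 < d1 \<Longrightarrow> norm (D x - id_blinfun) < 1 / 2"
    using contD[unfolded continuous_on_iff, rule_format, OF x0(1), of "1/2"] D_x0 by (auto simp: dist_norm)
  obtain d2 where d2': "d2 > 0" "\<And>x. x \<in> U \<Longrightarrow> dist x x0 < d2 \<Longrightarrow> norm (c'' x - c'' x0) < 1"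
    using cont[unfolded continuous_on_iff, rule_format, OF x0(1), of 1] by (auto simp: dist_norm)
  obtain d3 where d3: "d3 > 0" "ball x0 d3 \<subseteq> U"
    using \<open>open U\<close> x0(1) open_contains_ball by blast
  \<comment> \<open>on \<open>W\<close> the derivative of \<open>Psi\<close> is within \<open>1/2\<close> of the identity and \<open>c''\<close> is bounded\<close>
  define W where "W = ball x0 (min d3 (min d1 d2))"
  define B where "B = norm (c'' x0) + 1"
  have W: "open W" "x0 \<in> W" "W \<subseteq> U" using d1 d2' d3 by (auto simp: W_def)
  have DW: "norm (D x - id_blinfun) \<le> 1 / 2" and BW: "norm (c'' x) \<le> B" if "x \<in> W" for x
  proof -
    have "x \<in> U" "dist x x0 < d1" "dist x x0 < d2"
      using that W by (auto simp: W_def dist_commute)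
    then show "norm (D x - id_blinfun) \<le> 1 / 2" "norm (c'' x) \<le> B"
      using d1(2) d2'(2) norm_triangle_sub[of "c'' x" "c'' x0"] by (force simp: B_def)+
  qed
  have lower: "norm z \<le> 2 * norm (D x z)" if "x \<in> W" for x z
  proof -
    have "norm (D x z - z) = norm ((D x - id_blinfun) z)" by (simp add: blinfun.bilinear_simps)
    also have "\<dots> \<le> (1 / 2) * norm z"
      using DW[OF that] norm_blinfun[of "D x - id_blinfun" z] mult_right_mono[OF DW[OF that] norm_ge_zero[of z]]
      by linarith
    finally show ?thesis
      using norm_triangle_ineq2[of z "D x z"] by (simp add: norm_minus_commute)
  qed
  obtain U' V g g' where ift: "open U'" "U' \<subseteq> W" "x0 \<in> U'" "open V" "Psi x0 \<in> V" "homeomorphism U' V Psi g"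
    and dg: "\<And>y. y \<in> V \<Longrightarrow> (g has_derivative (g' y)) (at y)"
    and g': "\<And>y. y \<in> V \<Longrightarrow> g' y = inv (blinfun_apply (D (g y)))"
    and bij: "\<And>y. y \<in> V \<Longrightarrow> bij (blinfun_apply (D (g y)))"
  proof (rule inverse_function_theorem[of W Psi D x0 id_blinfun])
    show "(Psi has_derivative blinfun_apply (D x)) (at x)" if "x \<in> W" for x
      using dPsi W that by blast
    show "continuous_on W D" using contD W continuous_on_subset by blast
    show "id_blinfun o\<^sub>L D x0 = id_blinfun"
      unfolding D_x0 by (rule blinfun_eqI) simp
  qed (use W in auto)
  have gV: "g y \<in> U'" "Psi (g y) = y" if "y \<in> V" for y
    using ift(6) that by (auto simp: homeomorphism_def)
  have gPsi: "g (Psi x) = x" if "x \<in> U'" for x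
    using ift(6) that by (auto simp: homeomorphism_def)
  obtain rho where rho: "rho > 0" "ball 0 rho \<subseteq> V"
    using ift(4,5) Psi_x0 open_contains_ball by metis
  have chart: "g u = x0 + u" if u: "c' x0 u = 0" "norm u < rho" for u
  proof -
    have su: "s *\<^sub>R u \<in> V" if "s \<in> {0..1}" for s
    proof -
      have "norm (s *\<^sub>R u) \<le> norm u" using that by (auto intro: mult_left_le_one_le)
      then have "s *\<^sub>R u \<in> ball 0 rho" using u by simp
      then show ?thesis using rho by blast
    qed
    define y where "y s = g (s *\<^sub>R u)" for s
    define y' where "y' s = g' (s *\<^sub>R u) u" for s
    have yW: "y s \<in> W" if "s \<in> {0..1}" for s
      using gV su ift that by (auto simp: y_def)
    have y_deriv: "(y has_vector_derivative y' s) (at s)" if s: "s \<in> {0..1}" for s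
    proof -
      have "(y has_derivative (\<lambda>h. g' (s *\<^sub>R u) (h *\<^sub>R u))) (at s)"
        unfolding y_def
        by (rule has_derivative_compose[of "\<lambda>s. s *\<^sub>R u", OF _ dg[OF su[OF s]]])
           (auto intro!: derivative_eq_intros)
      then show ?thesis
        using has_derivative_linear[OF dg[OF su[OF s]]]
        by (simp add: has_vector_derivative_def y'_def linear_cmul)
    qed
    have Dy': "D (y s) (y' s) = u" if "s \<in> {0..1}" for s
      using g'[OF su[OF that]] bij[OF su[OF that]] by (simp add: y_def y'_def surj_f_inv_f bij_is_surj)
    have cy: "c (y s) = 0" if "s \<in> {0..1}" for s
      using c_Psi[of "y s"] gV(2)[OF su[OF that]] u by (simp add: y_def blinfun.bilinear_simps)
    have c'y: "c' (y s) (y' s) = 0" if "s \<in> {0..1}" for s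
      using c_D[of "y s" "y' s"] Dy'[OF that] u by simp
    define e where "e s = R (c' (y s) u)" for s
    \<comment> \<open>together with \<open>lower\<close> this bounds \<open>u - y' s\<close> by \<open>2 * norm (e s)\<close>\<close>
    have e_eq: "D (y s) (u - y' s) = e s" if "s \<in> {0..1}" for s
      using Dy'[OF that] u by (simp add: blinfun.bilinear_simps e_def D_apply[of _ u])
    have e_zero: "e s = 0" if "s \<in> {0..1}" for s
    proof (rule zero_of_linear_growth[OF _ _ _ that])
      fix s :: real assume s: "s \<in> {0..1}"
      have yU: "y s \<in> U" using yW[OF s] W by blast
      have "((\<lambda>s. c' (y s)) has_derivative (\<lambda>h. c'' (y s) (h *\<^sub>R y' s))) (at s)"
        using has_derivative_compose[OF y_deriv[OF s, unfolded has_vector_derivative_def] d2[OF yU]] .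
      then show "(e has_vector_derivative R (c'' (y s) (y' s) u)) (at s)"
        unfolding e_def has_vector_derivative_def
        by (auto intro!: derivative_eq_intros simp: blinfun.bilinear_simps)
      have "c'' (y s) (y' s) u = c'' (y s) (y' s) (u - y' s)"
        using flat[OF yU cy[OF s] c'y[OF s]] by (simp add: blinfun.bilinear_simps)
      moreover have "norm (R (c'' (y s) (y' s) (u - y' s))) \<le> norm R * ((B * (2 * norm u)) * (2 * norm (e s)))"
      proof -
        have "norm (c'' (y s) (y' s)) \<le> B * (2 * norm u)"
          using norm_blinfun[of "c'' (y s)" "y' s"] BW[OF yW[OF s]] lower[OF yW[OF s], of "y' s"] Dy'[OF s]
          by (smt (verit) mult_mono norm_ge_zero)
        moreover have "norm (u - y' s) \<le> 2 * norm (e s)"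
          using lower[OF yW[OF s], of "u - y' s"] e_eq[OF s] by simp
        ultimately have "norm (c'' (y s) (y' s) (u - y' s)) \<le> (B * (2 * norm u)) * (2 * norm (e s))"
          using norm_blinfun[of "c'' (y s) (y' s)" "u - y' s"] by (smt (verit) mult_mono norm_ge_zero)
        then show ?thesis
          using norm_blinfun[of R "c'' (y s) (y' s) (u - y' s)"]
          by (smt (verit) mult_left_mono norm_ge_zero)
      qed
      ultimately show "norm (R (c'' (y s) (y' s) u)) \<le> (norm R * B * 2 * norm u * 2) * norm (e s)"
        by (simp add: mult.assoc mult.left_commute)
    next
      show "e 0 = 0"
        using gPsi[OF ift(3)] u by (simp add: e_def y_def Psi_x0 blinfun.bilinear_simps)
    qed
    \<comment> \<open>the curve has constant velocity \<open>u\<close>\<close>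
    have y'_eq: "y' s = u" if "s \<in> {0..1}" for s
      using lower[OF yW[OF that], of "u - y' s"] e_eq[OF that] e_zero[OF that] by simp
    have "((\<lambda>s. y s - s *\<^sub>R u) has_derivative (\<lambda>h. 0)) (at s within {0..1})" if "s \<in> {0..1}" for s
    proof -
      have "((\<lambda>s. y s - s *\<^sub>R u) has_derivative (\<lambda>h. h *\<^sub>R u - h *\<^sub>R u)) (at s)"
        using y_deriv[OF that] unfolding y'_eq[OF that] has_vector_derivative_def
        by (intro derivative_intros) auto
      then show ?thesis by (simp add: has_derivative_at_withinI)
    qed
    then obtain k where "\<And>s. s \<in> {0..1} \<Longrightarrow> y s - s *\<^sub>R u = k"
      using has_derivative_zero_constant[of "{0..1::real}" "\<lambda>s. y s - s *\<^sub>R u"] by auto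
    from this[of 0] this[of 1] have "y 1 - 1 *\<^sub>R u = y 0 - 0 *\<^sub>R u" by simp
    moreover have "y 0 = x0" using gPsi[OF ift(3)] by (simp add: y_def Psi_x0)
    ultimately show ?thesis by (simp add: y_def algebra_simps)
  qed
  have "continuous (at x0) Psi"
    using dPsi[OF x0(1)] has_derivative_continuous by blast
  then obtain r1 where r1: "r1 > 0" "\<And>x. dist x x0 < r1 \<Longrightarrow> norm (Psi x) < rho"
    using rho(1) Psi_x0 unfolding continuous_at_eps_delta by (auto simp: dist_norm)
  obtain r2 where r2: "r2 > 0" "ball x0 r2 \<subseteq> U'"
    using ift(1,3) open_contains_ball by blast
  define r where "r = min rho (min r1 r2)"
  have "c x = 0 \<longleftrightarrow> c' x0 (x - x0) = 0" if x: "x \<in> ball x0 r" for x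
  proof
    assume "c' x0 (x - x0) = 0"
    moreover have nx: "norm (x - x0) < rho" using x by (simp add: r_def dist_norm norm_minus_commute)
    ultimately have "g (x - x0) = x" using chart by force
    moreover have "x - x0 \<in> V" using rho nx by (auto simp: subset_iff)
    ultimately show "c x = 0" using gV(2) c_Psi[of x] \<open>c' x0 (x - x0) = 0\<close> by metis
  next
    assume "c x = 0"
    then have "c' x0 (Psi x) = 0" by (simp add: c_Psi)
    moreover have "norm (Psi x) < rho" using r1 x by (simp add: r_def dist_commute)
    moreover have "x \<in> U'" using r2 x by (auto simp: r_def)
    ultimately show "c' x0 (x - x0) = 0" using chart gPsi by (metis add_diff_cancel_left')
  qed
  moreover have "r > 0" using rho r1 r2 by (simp add: r_def)
  moreover have "ball x0 r \<subseteq> ball x0 r2" by (auto simp: r_def)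
  then have "ball x0 r \<subseteq> U" using r2 ift W by blast
  ultimately show ?thesis by blast
qed

text \<open>
  The subspace \<open>K x\<close> describing \<open>M\<close> near \<open>x\<close> is determined by the germ of \<open>M\<close> at any nearby point of
  \<open>M\<close>, hence it is locally constant. By connectedness all of \<open>M\<close> lies in one affine subspace, and \<open>M\<close> is
  open and closed in the convex intersection of this subspace with \<open>U\<close>.
\<close>

lemma locally_affine_imp_convex:
  fixes M :: "'a::real_normed_vector set"
  assumes "connected M" "convex U" and closed: "closedin (top_of_set U) M"
    and local: "\<And>x. x \<in> M \<Longrightarrow> \<exists>K r. subspace K \<and> 0 < r \<and> ball x r \<subseteq> U \<and> (\<forall>y\<in>ball x r. y \<in> M \<longleftrightarrow> y - x \<in> K)"
  shows "convex M"
proof (cases "M = {}")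
  case False
  then obtain a where a: "a \<in> M" by blast
  obtain K r where K: "\<And>x. x \<in> M \<Longrightarrow> subspace (K x)" and r: "\<And>x. x \<in> M \<Longrightarrow> 0 < r x"
    and iff: "\<And>x y. x \<in> M \<Longrightarrow> y \<in> ball x (r x) \<Longrightarrow> y \<in> M \<longleftrightarrow> y - x \<in> K x"
    using local by metis
  \<comment> \<open>only points of \<open>M\<close> near \<open>y\<close> occur on the right, so \<open>K x\<close> depends on the germ of \<open>M\<close> at \<open>y\<close>\<close>
  have germ: "K x = {k. \<forall>\<^sub>F t in at_right 0. y + t *\<^sub>R k \<in> M}"
    if "x \<in> M" "y \<in> M" "y \<in> ball x (r x)" for x y
  proof (intro set_eqI iffI CollectI)
    have yx: "y - x \<in> K x" using iff that by blast
    have near: "\<forall>\<^sub>F t in at_right 0. 0 < t \<and> y + t *\<^sub>R k \<in> ball x (r x)" for k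
    proof -
      have "((\<lambda>t. y + t *\<^sub>R k) \<longlongrightarrow> y + 0 *\<^sub>R k) (at_right 0)"
        by (intro tendsto_intros)
      then have "\<forall>\<^sub>F t in at_right 0. y + t *\<^sub>R k \<in> ball x (r x)"
        by (rule topological_tendstoD) (use that in auto)
      then show ?thesis using eventually_at_right_less by (rule eventually_conj[rotated])
    qed
    fix k
    show "\<forall>\<^sub>F t in at_right 0. y + t *\<^sub>R k \<in> M" if k: "k \<in> K x"
      using near[of k]
    proof (rule eventually_mono)
      fix t :: real assume t: "0 < t \<and> y + t *\<^sub>R k \<in> ball x (r x)"
      have "(y - x) + t *\<^sub>R k \<in> K x"
        using k yx K[OF \<open>x \<in> M\<close>] by (simp add: subspace_add subspace_scale)
      then show "y + t *\<^sub>R k \<in> M"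
        using iff[OF \<open>x \<in> M\<close>, of "y + t *\<^sub>R k"] t by (simp add: algebra_simps)
    qed
    show "k \<in> K x" if "k \<in> {k. \<forall>\<^sub>F t in at_right 0. y + t *\<^sub>R k \<in> M}"
    proof -
      have "\<forall>\<^sub>F t in at_right 0. (0 < t \<and> y + t *\<^sub>R k \<in> ball x (r x)) \<and> y + t *\<^sub>R k \<in> M"
        using eventually_conj[OF near[of k] that[unfolded mem_Collect_eq]] .
      then obtain t where t: "0 < t" "y + t *\<^sub>R k \<in> ball x (r x)" "y + t *\<^sub>R k \<in> M"
        using eventually_happens'[OF trivial_limit_at_right_real] by blast
      then have "(y + t *\<^sub>R k - x) - (y - x) \<in> K x"
        using iff[OF \<open>x \<in> M\<close> t(2)] yx K[OF \<open>x \<in> M\<close>] subspace_diff by blast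
      then have "(1 / t) *\<^sub>R (t *\<^sub>R k) \<in> K x"
        using subspace_scale[OF K[OF \<open>x \<in> M\<close>], of "t *\<^sub>R k" "1 / t"] by simp
      then show ?thesis using t(1) by simp
    qed
  qed
  have same: "K y = K x" if "x \<in> M" "y \<in> M" "y \<in> ball x (r x)" for x y
    using germ[OF that] germ[OF that(2,2)] r[OF that(2)] by simp
  have rel: "y - a \<in> K a \<and> K y = K a" if "y \<in> M" for y
  proof (rule connected_equivalence_relation[OF \<open>connected M\<close> a that,
        where R = "\<lambda>x y. y - x \<in> K x \<and> K y = K x"])
    show "x - y \<in> K y \<and> K x = K y" if "y - x \<in> K x \<and> K y = K x" "x \<in> M" "y \<in> M" for x y
      using that K subspace_neg[of "K x" "y - x"] by simp
    show "z - x \<in> K x \<and> K z = K x"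
      if "y - x \<in> K x \<and> K y = K x" "z - y \<in> K y \<and> K z = K y" "x \<in> M" "y \<in> M" "z \<in> M" for x y z
      using that K subspace_add[of "K x" "z - y" "y - x"] by simp
    show "\<exists>T. openin (top_of_set M) T \<and> x \<in> T \<and> (\<forall>y\<in>T. y - x \<in> K x \<and> K y = K x)" if "x \<in> M" for x
    proof (intro exI conjI ballI)
      show "openin (top_of_set M) (M \<inter> ball x (r x))" by (simp add: openin_open_Int)
      show "x \<in> M \<inter> ball x (r x)" using that r by simp
      show "y - x \<in> K x" "K y = K x" if "y \<in> M \<inter> ball x (r x)" for y
        using that \<open>x \<in> M\<close> iff same by blast+
    qed
  qed
  define T where "T = U \<inter> {x. x - a \<in> K a}"
  have "convex {x. x - a \<in> K a}"
  proof -
    have "{x. x - a \<in> K a} = (+) a ` K a" by (auto simp: image_iff algebra_simps intro!: bexI[of _ "_ - a"])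
    then show ?thesis using subspace_imp_convex[OF K[OF a]] convex_translation by simp
  qed
  then have cT: "convex T" using \<open>convex U\<close> by (simp add: T_def convex_Int)
  have MT: "M \<subseteq> T" using rel closedin_subset[OF closed] by (auto simp: T_def)
  have "M = T \<inter> (\<Union>x\<in>M. ball x (r x))"
  proof
    show "M \<subseteq> T \<inter> (\<Union>x\<in>M. ball x (r x))" using MT r by auto
    show "T \<inter> (\<Union>x\<in>M. ball x (r x)) \<subseteq> M"
    proof
      fix y assume "y \<in> T \<inter> (\<Union>x\<in>M. ball x (r x))"
      then obtain x where x: "x \<in> M" "y \<in> ball x (r x)" "y - a \<in> K a" by (auto simp: T_def)
      have "(y - a) - (x - a) \<in> K a" using rel[OF x(1)] x(3) K[OF a] subspace_diff by blast
      then show "y \<in> M" using iff[OF x(1,2)] rel[OF x(1)] by simp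
    qed
  qed
  then have "openin (top_of_set T) M"
    by (metis openin_open_Int open_UN open_ball)
  moreover have "closedin (top_of_set T) M"
    using closed MT by (rule closedin_subset_trans) (simp add: T_def)
  ultimately have "M = T"
    using convex_connected[OF cT] a unfolding connected_clopen by blast
  then show ?thesis using cT by simp
qed simp

section \<open>First and second derivatives\<close>

text \<open>
  The second difference of \<open>g\<close> over the parallelogram spanned by \<open>t u\<close> and \<open>t v\<close> is \<open>t\<^sup>2 * g'' v u\<close> up
  to \<open>o(t\<^sup>2)\<close>. The mean value theorem in direction \<open>u\<close> reduces it to a first difference of \<open>g'\<close>, so
  differentiability of \<open>g'\<close> at the single point \<open>x0\<close> suffices.
\<close>

lemma second_difference_quotient:
  fixes g :: "'a::real_normed_vector \<Rightarrow> real"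
  assumes d1: "\<And>x. (g has_derivative g' x) (at x)"
    and d2: "((\<lambda>x. g' x u) has_derivative (\<lambda>h. g'' h u)) (at x0)"
    and "e > 0"
  obtains d where "d > 0" "\<And>t. \<lbrakk>0 < t; t < d\<rbrakk> \<Longrightarrow>
    \<bar>g (x0 + t *\<^sub>R u + t *\<^sub>R v) - g (x0 + t *\<^sub>R u) - g (x0 + t *\<^sub>R v) + g x0 - t\<^sup>2 * g'' v u\<bar> \<le> e * t\<^sup>2"
proof -
  have lin: "linear (\<lambda>h. g'' h u)" using d2 has_derivative_linear by blast
  \<comment> \<open>both arguments at which \<open>g'\<close> is expanded have norm at most \<open>t * N\<close>, and so does the sum of the norms\<close>
  define N where "N = 2 * norm u + norm v + 1"
  have N: "N > 0" by (simp add: N_def add_nonneg_pos)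
  obtain d where d: "d > 0"
    "\<And>h. norm h < d \<Longrightarrow> \<bar>g' (x0 + h) u - g' x0 u - g'' h u\<bar> \<le> (e / N) * norm h"
  proof -
    have "\<exists>d>0. \<forall>y. norm (y - x0) < d \<longrightarrow> norm (g' y u - g' x0 u - g'' (y - x0) u) \<le> (e / N) * norm (y - x0)"
      using d2[unfolded has_derivative_at_alt, THEN conjunct2, rule_format, of "e / N"] N \<open>e > 0\<close> by simp
    then obtain d where "d > 0"
      "\<And>y. norm (y - x0) < d \<Longrightarrow> norm (g' y u - g' x0 u - g'' (y - x0) u) \<le> (e / N) * norm (y - x0)" by blast
    then show thesis using that[of d] by (metis add_diff_cancel_left' real_norm_def)
  qed
  have "\<bar>g (x0 + t *\<^sub>R u + t *\<^sub>R v) - g (x0 + t *\<^sub>R u) - g (x0 + t *\<^sub>R v) + g x0 - t\<^sup>2 * g'' v u\<bar> \<le> e * t\<^sup>2"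
    if t: "0 < t" "t < d / N" for t
  proof -
    define p where "p s = g (x0 + (s *\<^sub>R u + t *\<^sub>R v)) - g (x0 + s *\<^sub>R u)" for s
    have "\<exists>s>0. s < t \<and> p t - p 0 = (t - 0) * (g' (x0 + (s *\<^sub>R u + t *\<^sub>R v)) u - g' (x0 + s *\<^sub>R u) u)"
    proof (rule MVT2[OF t(1)])
      fix s
      have "((\<lambda>s. g (x0 + (s *\<^sub>R u + t *\<^sub>R v))) has_derivative (\<lambda>h. g' (x0 + (s *\<^sub>R u + t *\<^sub>R v)) (h *\<^sub>R u))) (at s)"
        "((\<lambda>s. g (x0 + s *\<^sub>R u)) has_derivative (\<lambda>h. g' (x0 + s *\<^sub>R u) (h *\<^sub>R u))) (at s)"
        by (rule has_derivative_compose[OF _ d1]; auto intro!: derivative_eq_intros)+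
      then have "(p has_derivative (\<lambda>h. g' (x0 + (s *\<^sub>R u + t *\<^sub>R v)) (h *\<^sub>R u) - g' (x0 + s *\<^sub>R u) (h *\<^sub>R u))) (at s)"
        unfolding p_def by (rule has_derivative_diff)
      then show "DERIV p s :> g' (x0 + (s *\<^sub>R u + t *\<^sub>R v)) u - g' (x0 + s *\<^sub>R u) u"
        unfolding has_field_derivative_def
        by (rule has_derivative_eq_rhs)
           (simp add: fun_eq_iff linear_cmul[OF has_derivative_linear[OF d1]] algebra_simps)
    qed
    then obtain s where s: "0 < s" "s < t"
      "p t - p 0 = t * (g' (x0 + (s *\<^sub>R u + t *\<^sub>R v)) u - g' (x0 + s *\<^sub>R u) u)" by auto
    have su: "norm (s *\<^sub>R u) \<le> t * norm u" using s by (simp add: mult_right_mono)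
    have sutv: "norm (s *\<^sub>R u + t *\<^sub>R v) \<le> t * norm u + t * norm v"
      using norm_triangle_ineq[of "s *\<^sub>R u" "t *\<^sub>R v"] su t by simp
    have tN: "t * N < d" using t N by (simp add: pos_less_divide_eq)
    have "t * norm u + t * norm v < t * N" "t * norm u < t * N"
      using t unfolding distrib_left[symmetric] by (simp_all add: N_def add_nonneg_pos add_pos_nonneg)
    then have small: "norm (s *\<^sub>R u) < d" "norm (s *\<^sub>R u + t *\<^sub>R v) < d"
      using su sutv tN by linarith+
    have "\<bar>g' (x0 + (s *\<^sub>R u + t *\<^sub>R v)) u - g' x0 u - g'' (s *\<^sub>R u + t *\<^sub>R v) u\<bar> \<le> (e / N) * (t * norm u + t * norm v)"
      using d(2)[OF small(2)] sutv N \<open>e > 0\<close> by (meson mult_left_mono order_trans divide_nonneg_pos less_imp_le)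
    moreover have "\<bar>g' (x0 + s *\<^sub>R u) u - g' x0 u - g'' (s *\<^sub>R u) u\<bar> \<le> (e / N) * (t * norm u)"
      using d(2)[OF small(1)] su N \<open>e > 0\<close> by (meson mult_left_mono order_trans divide_nonneg_pos less_imp_le)
    moreover have "g'' (s *\<^sub>R u + t *\<^sub>R v) u = g'' (s *\<^sub>R u) u + t * g'' v u"
      using linear_add[OF lin] linear_cmul[OF lin] by simp
    moreover have "(e / N) * (t * norm u + t * norm v) + (e / N) * (t * norm u) \<le> (e / N) * (t * N)"
      unfolding distrib_left[symmetric] using t N \<open>e > 0\<close>
      by (intro mult_left_mono) (auto simp: N_def algebra_simps)
    moreover have "(e / N) * (t * N) = e * t" using N by simp
    ultimately have "\<bar>(g' (x0 + (s *\<^sub>R u + t *\<^sub>R v)) u - g' (x0 + s *\<^sub>R u) u) - t * g'' v u\<bar> \<le> e * t"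
      by linarith
    then have "t * \<bar>(g' (x0 + (s *\<^sub>R u + t *\<^sub>R v)) u - g' (x0 + s *\<^sub>R u) u) - t * g'' v u\<bar> \<le> t * (e * t)"
      using t(1) by (intro mult_left_mono) auto
    then have "\<bar>t * ((g' (x0 + (s *\<^sub>R u + t *\<^sub>R v)) u - g' (x0 + s *\<^sub>R u) u) - t * g'' v u)\<bar> \<le> t * (e * t)"
      using t(1) by (simp add: abs_mult)
    moreover have "p t - p 0 - t\<^sup>2 * g'' v u = t * ((g' (x0 + (s *\<^sub>R u + t *\<^sub>R v)) u - g' (x0 + s *\<^sub>R u) u) - t * g'' v u)"
      unfolding s(3) by (simp add: power2_eq_square algebra_simps)
    ultimately have "\<bar>p t - p 0 - t\<^sup>2 * g'' v u\<bar> \<le> e * t\<^sup>2"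
      by (simp add: power2_eq_square mult.left_commute)
    then show ?thesis by (simp add: p_def algebra_simps)
  qed
  then show thesis using that[of "d / N"] d(1) N by simp
qed

text \<open>
  The second difference is symmetric in \<open>u\<close> and \<open>v\<close>.
\<close>

lemma second_derivative_symmetric:
  fixes g :: "'a::real_normed_vector \<Rightarrow> real"
  assumes d1: "\<And>x. (g has_derivative g' x) (at x)"
    and d2: "\<And>u. ((\<lambda>x. g' x u) has_derivative (\<lambda>h. g'' h u)) (at x0)"
  shows "g'' u v = g'' v u"
proof (rule ccontr)
  assume "g'' u v \<noteq> g'' v u"
  define e where "e = \<bar>g'' u v - g'' v u\<bar> / 3"
  have "e > 0" using \<open>g'' u v \<noteq> g'' v u\<close> by (simp add: e_def)
  obtain da where da: "da > 0" "\<And>t. \<lbrakk>0 < t; t < da\<rbrakk> \<Longrightarrow>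
    \<bar>g (x0 + t *\<^sub>R u + t *\<^sub>R v) - g (x0 + t *\<^sub>R u) - g (x0 + t *\<^sub>R v) + g x0 - t\<^sup>2 * g'' v u\<bar> \<le> e * t\<^sup>2"
    using second_difference_quotient[where g'' = g'' and v = v, OF d1 d2[of u] \<open>e > 0\<close>] by blast
  obtain db where db: "db > 0" "\<And>t. \<lbrakk>0 < t; t < db\<rbrakk> \<Longrightarrow>
    \<bar>g (x0 + t *\<^sub>R v + t *\<^sub>R u) - g (x0 + t *\<^sub>R v) - g (x0 + t *\<^sub>R u) + g x0 - t\<^sup>2 * g'' u v\<bar> \<le> e * t\<^sup>2"
    using second_difference_quotient[where g'' = g'' and v = u, OF d1 d2[of v] \<open>e > 0\<close>] by blast
  define t where "t = min da db / 2"
  have t: "0 < t" "t < da" "t < db" using da db by (auto simp: t_def)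
  have "x0 + t *\<^sub>R v + t *\<^sub>R u = x0 + t *\<^sub>R u + t *\<^sub>R v" by simp
  then have "\<bar>t\<^sup>2 * g'' u v - t\<^sup>2 * g'' v u\<bar> \<le> 2 * (e * t\<^sup>2)"
    using da(2)[OF t(1,2)] db(2)[OF t(1,3)] by (smt (verit))
  moreover have "\<bar>t\<^sup>2 * g'' u v - t\<^sup>2 * g'' v u\<bar> = t\<^sup>2 * \<bar>g'' u v - g'' v u\<bar>"
    by (simp add: abs_mult right_diff_distrib[symmetric])
  ultimately have "t\<^sup>2 * \<bar>g'' u v - g'' v u\<bar> \<le> t\<^sup>2 * (2 * e)"
    by (simp add: mult_ac)
  then have "\<bar>g'' u v - g'' v u\<bar> \<le> 2 * e" using t(1) by simp
  then show False using \<open>e > 0\<close> by (simp add: e_def)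
qed

text \<open>
  Convexity makes the second difference with \<open>u = v\<close> nonnegative.
\<close>

lemma convex_imp_second_derivative_nonneg:
  fixes g :: "'a::real_normed_vector \<Rightarrow> real"
  assumes conv: "convex_on UNIV g"
    and d1: "\<And>x. (g has_derivative g' x) (at x)"
    and d2: "((\<lambda>x. g' x v) has_derivative (\<lambda>h. g'' h v)) (at x0)"
  shows "0 \<le> g'' v v"
proof (rule ccontr)
  assume "\<not> 0 \<le> g'' v v"
  then have neg: "- g'' v v / 2 > 0" by simp
  obtain d where d: "d > 0" "\<And>t. \<lbrakk>0 < t; t < d\<rbrakk> \<Longrightarrow>
    \<bar>g (x0 + t *\<^sub>R v + t *\<^sub>R v) - g (x0 + t *\<^sub>R v) - g (x0 + t *\<^sub>R v) + g x0 - t\<^sup>2 * g'' v v\<bar>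
      \<le> (- g'' v v / 2) * t\<^sup>2"
    using second_difference_quotient[where g'' = g'' and v = v, OF d1 d2 neg] by blast
  define t where "t = d / 2"
  have t: "0 < t" "t < d" using d(1) by (auto simp: t_def)
  have "g ((1 - 1/2) *\<^sub>R x0 + (1/2) *\<^sub>R (x0 + t *\<^sub>R v + t *\<^sub>R v))
      \<le> (1 - 1/2) * g x0 + (1/2) * g (x0 + t *\<^sub>R v + t *\<^sub>R v)"
    by (rule convex_onD[OF conv]) auto
  moreover have "(1 - 1/2) *\<^sub>R x0 + (1/2) *\<^sub>R (x0 + t *\<^sub>R v + t *\<^sub>R v) = x0 + t *\<^sub>R v"
  proof -
    have "(1 - 1/2) *\<^sub>R x0 + (1/2) *\<^sub>R (x0 + t *\<^sub>R v + t *\<^sub>R v) = (1/2 + 1/2) *\<^sub>R x0 + (1/2 + 1/2) *\<^sub>R (t *\<^sub>R v)"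
      by (simp only: scaleR_add_left scaleR_add_right) simp
    then show ?thesis by simp
  qed
  ultimately have "g (x0 + t *\<^sub>R v + t *\<^sub>R v) - g (x0 + t *\<^sub>R v) - g (x0 + t *\<^sub>R v) + g x0 \<ge> 0"
    by simp
  then have "- (t\<^sup>2 * g'' v v) \<le> (- g'' v v / 2) * t\<^sup>2"
    using d(2)[OF t] by linarith
  then have "t\<^sup>2 * g'' v v \<ge> 0" by (simp add: mult.commute)
  then show False using neg t(1) by (simp add: zero_le_mult_iff)
qed

text \<open>
  The partial derivatives in the first variable are two-sided even for \<open>t\<close> on the boundary of \<open>T\<close>, since a
  section \<open>UNIV \<times> {t}\<close> lies entirely in \<open>UNIV \<times> T\<close>.
\<close>

lemma C2_on_sections:
  fixes g :: "'a::real_normed_vector \<times> 'p::real_normed_vector \<Rightarrow> 'b::real_normed_vector"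
  assumes "C2_on (UNIV \<times> T) g"
  obtains g' :: "'a \<times> 'p \<Rightarrow> 'a \<Rightarrow>\<^sub>L 'b" and g'' :: "'a \<times> 'p \<Rightarrow> 'a \<Rightarrow>\<^sub>L 'a \<Rightarrow>\<^sub>L 'b"
  where "continuous_on (UNIV \<times> T) g" "continuous_on (UNIV \<times> T) g'" "continuous_on (UNIV \<times> T) g''"
    and "\<And>x t. t \<in> T \<Longrightarrow> ((\<lambda>x. g (x, t)) has_derivative blinfun_apply (g' (x, t))) (at x)"
    and "\<And>x t. t \<in> T \<Longrightarrow> ((\<lambda>x. g' (x, t)) has_derivative blinfun_apply (g'' (x, t))) (at x)"
proof -
  obtain G G' where d1: "\<And>p. p \<in> UNIV \<times> T \<Longrightarrow> (g has_derivative blinfun_apply (G p)) (at p within UNIV \<times> T)"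
    and d2: "\<And>p. p \<in> UNIV \<times> T \<Longrightarrow> (G has_derivative blinfun_apply (G' p)) (at p within UNIV \<times> T)"
    and cont: "continuous_on (UNIV \<times> T) G'"
    using assms unfolding C2_on_def by blast
  define inl :: "'a \<Rightarrow>\<^sub>L ('a \<times> 'p)" where "inl = Blinfun (\<lambda>x. (x, 0))"
  have inl: "blinfun_apply inl x = (x, 0)" for x
    unfolding inl_def by (subst bounded_linear_Blinfun_apply) (auto intro!: bounded_linear_intros)
  define restr :: "(('a \<times> 'p) \<Rightarrow>\<^sub>L 'b) \<Rightarrow>\<^sub>L ('a \<Rightarrow>\<^sub>L 'b)" where "restr = Blinfun (\<lambda>L. L o\<^sub>L inl)"
  have restr: "blinfun_apply restr L = L o\<^sub>L inl" for L
    unfolding restr_def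
    by (subst bounded_linear_Blinfun_apply) (auto intro!: bounded_linear_intros)
  have section_deriv: "((\<lambda>x. h (x, t)) has_derivative (\<lambda>v. L (v, 0))) (at x)"
    if "(h has_derivative L) (at (x, t) within UNIV \<times> T)" "t \<in> T"
    for h :: "'a \<times> 'p \<Rightarrow> 'c::real_normed_vector" and L x t
  proof -
    have "((\<lambda>x. (x, t)) has_derivative (\<lambda>v. (v, 0))) (at x within UNIV)"
      by (intro derivative_eq_intros) auto
    then show ?thesis
      using has_derivative_in_compose[of "\<lambda>x. (x, t)" "\<lambda>v. (v, 0)" x UNIV h L]
        that has_derivative_subset[OF that(1), of "range (\<lambda>x. (x, t))"] by auto
  qed
  show thesis
  proof (rule that[of "\<lambda>p. restr (G p)" "\<lambda>p. restr o\<^sub>L (G' p o\<^sub>L inl)"])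
    show "continuous_on (UNIV \<times> T) g"
      by (rule has_derivative_continuous_on[OF d1])
    have contG: "continuous_on (UNIV \<times> T) G"
      by (rule has_derivative_continuous_on[OF d2])
    show "continuous_on (UNIV \<times> T) (\<lambda>p. restr (G p))"
      by (intro continuous_intros contG)
    show "continuous_on (UNIV \<times> T) (\<lambda>p. restr o\<^sub>L (G' p o\<^sub>L inl))"
      by (intro continuous_intros cont)
    show "((\<lambda>x. g (x, t)) has_derivative blinfun_apply (restr (G (x, t)))) (at x)" if "t \<in> T" for x t
      using section_deriv[OF d1, of x t] that by (auto simp: restr inl o_def elim!: has_derivative_eq_rhs)
    show "((\<lambda>x. restr (G (x, t))) has_derivative blinfun_apply (restr o\<^sub>L (G' (x, t) o\<^sub>L inl))) (at x)"
      if "t \<in> T" for x t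
    proof -
      have "((\<lambda>x. restr (G (x, t))) has_derivative (\<lambda>v. restr (G' (x, t) (v, 0)))) (at x)"
        using section_deriv[OF d2, of x t] that bounded_linear.has_derivative[OF blinfun.bounded_linear_right] by auto
      then show ?thesis by (rule has_derivative_eq_rhs) (auto simp: inl)
    qed
  qed
qed

lemma derivative_zero_along_segment:
  assumes d: "(c has_derivative c') (at x)"
    and zero: "\<And>z. z \<in> closed_segment x y \<Longrightarrow> c z = 0"
  shows "c' (y - x) = 0"
proof -
  let ?l = "\<lambda>t. x + t *\<^sub>R (y - x)"
  have "((\<lambda>t. c (?l t)) has_derivative (\<lambda>h. c' (h *\<^sub>R (y - x)))) (at 0 within cbox 0 (1::real))"
    by (rule has_derivative_compose[of ?l]) (use d in \<open>auto intro!: derivative_eq_intros\<close>)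
  then have 1: "((\<lambda>t. c (?l t)) has_vector_derivative c' (y - x)) (at 0 within cbox 0 (1::real))"
    using has_derivative_linear[OF d] by (simp add: has_vector_derivative_def linear_cmul)
  have "c (?l t) = 0" if "t \<in> cbox 0 (1::real)" for t
    using that by (intro zero) (auto simp: in_segment algebra_simps intro!: exI[of _ t])
  then have 2: "((\<lambda>t. c (?l t)) has_vector_derivative 0) (at 0 within cbox 0 (1::real))"
    by (intro has_vector_derivative_transform[OF _ _ has_vector_derivative_const, of 0 _ _ 0]) auto
  show ?thesis
    using vector_derivative_unique_within_closed_interval[OF _ _ 1 2] by simp
qed

text \<open>
  The mean value theorem for \<open>phi\<close>, and then for its directional derivative, which starts at \<open>0\<close>.
\<close>

lemma strict_minimum_on_segment:
  fixes phi :: "'a::real_normed_vector \<Rightarrow> real"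
  assumes seg: "closed_segment x y \<subseteq> M" and "x \<noteq> y"
    and d1: "\<And>z. z \<in> M \<Longrightarrow> (phi has_derivative phi' z) (at z)"
    and d2: "\<And>z. z \<in> M \<Longrightarrow> ((\<lambda>z. phi' z (y - x)) has_derivative (\<lambda>h. phi'' z h (y - x))) (at z)"
    and stationary: "phi' x (y - x) = 0"
    and pos: "\<And>z. z \<in> closed_segment x y \<Longrightarrow> 0 < phi'' z (y - x) (y - x)"
  shows "phi x < phi y"
proof -
  define v where "v = y - x"
  define l where "l t = x + t *\<^sub>R v" for t :: real
  have l: "l t \<in> closed_segment x y" if "0 \<le> t" "t \<le> 1" for t
    using that by (auto simp: in_segment l_def v_def algebra_simps intro!: exI[of _ t])
  have dl: "(l has_derivative (\<lambda>h. h *\<^sub>R v)) (at t)" for t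
    unfolding l_def by (auto intro!: derivative_eq_intros)
  have chain: "((\<lambda>t. F (l t)) has_real_derivative F' v) (at t)" if "(F has_derivative F') (at (l t))" for F :: "'a \<Rightarrow> real" and F' t
    unfolding has_field_derivative_def
    using has_derivative_compose[OF dl that] by (rule has_derivative_eq_rhs)
      (simp add: fun_eq_iff linear_cmul[OF has_derivative_linear[OF that]] mult.commute)
  obtain s where s: "0 < s" "s < 1" "phi (l 1) - phi (l 0) = (1 - 0) * phi' (l s) v"
    using MVT2[of 0 1 "\<lambda>t. phi (l t)" "\<lambda>t. phi' (l t) v"] chain[OF d1] l seg by (meson subsetD zero_less_one)
  obtain r where r: "0 < r" "r < s" "phi' (l s) v - phi' (l 0) v = (s - 0) * phi'' (l r) v v"
    using MVT2[of 0 s "\<lambda>t. phi' (l t) v" "\<lambda>t. phi'' (l t) v v"] chain[OF d2[folded v_def]] l seg s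
    by (meson order_trans subsetD less_imp_le)
  have "0 < phi'' (l r) v v" using pos[folded v_def] l r s by simp
  moreover have "phi' (l 0) v = 0" using stationary by (simp add: l_def v_def)
  ultimately have "0 < phi' (l s) v" using r s(1) by simp
  then show ?thesis using s by (simp add: l_def v_def)
qed

section \<open>The KKT system of the barrier problem\<close>

text \<open>
  The Hessian of the Lagrangian in \<open>x\<close>, with \<open>F\<close> and \<open>C\<close> in the place of the second derivatives of \<open>f\<close>
  and \<open>c\<close>.
\<close>

definition barrier_hessian ::
  "'n set \<Rightarrow> real \<Rightarrow> ((real^'n) \<Rightarrow>\<^sub>L (real^'n) \<Rightarrow>\<^sub>L real) \<Rightarrow> ((real^'n) \<Rightarrow>\<^sub>L (real^'n) \<Rightarrow>\<^sub>L (real^'k)) \<Rightarrow>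
    real^'k \<Rightarrow> real^'n \<Rightarrow> real^'n \<Rightarrow> real^'n \<Rightarrow> real" where
  "barrier_hessian I \<mu> F C lam x u v =
     F u v + \<mu> * (\<Sum>i\<in>I. u $ i * v $ i / (x $ i)\<^sup>2) + lam \<bullet> C u v"

definition positive_orthant :: "'n set \<Rightarrow> (real^'n) set" where
  "positive_orthant I = {x. \<forall>i\<in>I. 0 < x $ i}"

lemma open_positive_orthant: "open (positive_orthant (I :: 'n::finite set))"
proof -
  have "positive_orthant I = (\<Inter>i\<in>I. {x. 0 < x $ i})" by (auto simp: positive_orthant_def)
  then show ?thesis
    by (auto intro!: open_INT open_Collect_less continuous_intros)
qed

lemma convex_positive_orthant: "convex (positive_orthant (I :: 'n::finite set))"
proof -
  have "positive_orthant I = (\<Inter>i\<in>I. {x. 0 < x $ i})" by (auto simp: positive_orthant_def)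
  moreover have "convex {x :: real^'n. 0 < x $ i}" for i
    by (auto simp: convex_alt) (smt (verit) mult_nonneg_nonneg mult_pos_pos)
  ultimately show ?thesis using convex_INT[of I "\<lambda>i. {x :: real^'n. 0 < x $ i}"] by simp
qed

lemma feasible_interior_eq: "feasible_interior I c \<theta> = {x \<in> positive_orthant I. c (x, \<theta>) = 0}"
  by (auto simp: feasible_interior_def positive_orthant_def)

lemma bilinear_barrier_hessian: "bilinear (barrier_hessian I \<mu> F C lam x)"
  unfolding bilinear_def
  by (intro conjI allI linearI)
     (simp_all add: barrier_hessian_def blinfun.bilinear_simps inner_add_right algebra_simps
       add_divide_distrib sum.distrib sum_distrib_left)

lemma barrier_log_derivative:
  assumes "y \<in> positive_orthant I"
  shows "((\<lambda>y. \<Sum>i\<in>I. ln (y $ i)) has_derivative (\<lambda>h. \<Sum>i\<in>I. h $ i / y $ i)) (at y)"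
proof (rule has_derivative_sum)
  fix i assume "i \<in> I"
  then have "0 < y $ i" using assms by (simp add: positive_orthant_def)
  then show "((\<lambda>y. ln (y $ i)) has_derivative (\<lambda>h. h $ i / y $ i)) (at y)"
    by (auto intro!: derivative_eq_intros bounded_linear_imp_has_derivative simp: divide_inverse mult.commute)
qed

lemma barrier_log_second_derivative:
  assumes "y \<in> positive_orthant I"
  shows "((\<lambda>y. \<Sum>i\<in>I. v $ i / y $ i) has_derivative (\<lambda>h. - (\<Sum>i\<in>I. h $ i * v $ i / (y $ i)\<^sup>2))) (at y)"
proof -
  have "((\<lambda>y. \<Sum>i\<in>I. v $ i / y $ i) has_derivative (\<lambda>h. \<Sum>i\<in>I. - (h $ i * v $ i / (y $ i)\<^sup>2))) (at y)"
  proof (rule has_derivative_sum)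
    fix i assume "i \<in> I"
    then have "0 < y $ i" using assms by (simp add: positive_orthant_def)
    then show "((\<lambda>y. v $ i / y $ i) has_derivative (\<lambda>h. - (h $ i * v $ i / (y $ i)\<^sup>2))) (at y)"
      by (auto intro!: derivative_eq_intros bounded_linear_imp_has_derivative
        simp: fun_eq_iff field_simps power2_eq_square)
  qed
  then show ?thesis by (simp add: sum_negf)
qed

lemma block_vec_nth [simp]:
  "block_vec x w $ Inl i = x $ i" "block_vec x w $ Inr j = w $ j"
  by (simp_all add: block_vec_def)

lemma block_proj [simp]: "block_fst (block_vec x w) = x" "block_snd (block_vec x w) = w"
  by (simp_all add: block_fst_def block_snd_def vec_eq_iff)

lemma block_vec_eq_0 [simp]: "block_vec x w = 0 \<longleftrightarrow> x = 0 \<and> w = 0"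
proof
  assume "block_vec x w = 0"
  then have "block_vec x w $ Inl i = 0" "block_vec x w $ Inr j = 0" for i j by simp_all
  then show "x = 0 \<and> w = 0" by (simp add: vec_eq_iff)
next
  assume "x = 0 \<and> w = 0"
  then show "block_vec x w = 0" by (simp add: vec_eq_iff block_vec_def split: sum.split)
qed

lemma bounded_linear_block_fst: "bounded_linear (block_fst :: real^('n::finite + 'k::finite) \<Rightarrow> real^'n)"
  by (simp add: linear_conv_bounded_linear[symmetric] linear_iff block_fst_def vec_eq_iff)

lemma bounded_linear_block_snd: "bounded_linear (block_snd :: real^('n::finite + 'k::finite) \<Rightarrow> real^'k)"
  by (simp add: linear_conv_bounded_linear[symmetric] linear_iff block_snd_def vec_eq_iff)

lemma has_derivative_vec_nthI:
  fixes f :: "'a::real_normed_vector \<Rightarrow> real^'n"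
  assumes "\<And>i. ((\<lambda>x. f x $ i) has_derivative (\<lambda>h. f' h $ i)) F"
  shows "(f has_derivative f') F"
proof -
  have "((\<lambda>x. \<Sum>i\<in>UNIV. (f x $ i) *\<^sub>R axis i 1) has_derivative (\<lambda>h. \<Sum>i\<in>UNIV. (f' h $ i) *\<^sub>R axis i (1::real))) F"
    by (intro derivative_intros assms)
  then show ?thesis
    by (simp add: basis_expansion scalar_mult_eq_scaleR[symmetric])
qed

lemma lagrangian_derivative:
  assumes df: "((\<lambda>x. f (x, \<theta>)) has_derivative blinfun_apply F) (at y)"
    and dc: "((\<lambda>x. c (x, \<theta>)) has_derivative blinfun_apply C) (at y)"
    and y: "y \<in> positive_orthant I"
  shows "((\<lambda>y. lagrangian I f c \<mu> y w \<theta>) has_derivative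
      (\<lambda>h. F h - \<mu> * (\<Sum>i\<in>I. h $ i / y $ i) + w \<bullet> C h)) (at y)"
  unfolding lagrangian_def
  by (intro derivative_intros df dc barrier_log_derivative y)

lemma gradient_lagrangian:
  assumes df: "((\<lambda>x. f (x, \<theta>)) has_derivative blinfun_apply F) (at y)"
    and dc: "((\<lambda>x. c (x, \<theta>)) has_derivative blinfun_apply C) (at y)"
    and y: "y \<in> positive_orthant I"
  shows "gradient (\<lambda>y. lagrangian I f c \<mu> y w \<theta>) y $ i =
     F (axis i 1) - \<mu> * (\<Sum>j\<in>I. axis i 1 $ j / y $ j) + w \<bullet> C (axis i 1)"
  unfolding gradient_def
  by (simp add: frechet_derivative_at[OF lagrangian_derivative[where f = f and c = c and \<theta> = \<theta>, OF assms], symmetric])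

text \<open>
  Near \<open>(x, lam)\<close> the residual has a closed form, \<open>Phi\<close>, because the logarithms are smooth on the open
  set of positive points. The derivative of \<open>Phi\<close> sends \<open>(v, w)\<close> to the left-hand sides of the KKT
  equations tested on the standard basis.
\<close>

lemma nonsingular_imp_kkt_nondegenerate:
  fixes f :: "(real^'n) \<times> real \<Rightarrow> real" and c :: "(real^'n) \<times> real \<Rightarrow> real^'k"
  assumes df: "\<And>y. ((\<lambda>x. f (x, \<theta>)) has_derivative blinfun_apply (f' y)) (at y)"
    and ddf: "(f' has_derivative blinfun_apply f'') (at x)"
    and dc: "\<And>y. ((\<lambda>x. c (x, \<theta>)) has_derivative blinfun_apply (c' y)) (at y)"
    and ddc: "(c' has_derivative blinfun_apply c'') (at x)"
    and x: "x \<in> feasible_interior I c \<theta>"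
    and nonsing: "\<not> singular_point I f c \<mu> \<theta> x lam"
  shows "kkt_nondegenerate (barrier_hessian I \<mu> f'' c'' lam x) (c' x)"
proof -
  let ?H = "barrier_hessian I \<mu> f'' c'' lam x"
  let ?z = "block_vec x lam"
  define Phi where "Phi z = block_vec (\<chi> i. f' (block_fst z) (axis i 1)
      - \<mu> * (\<Sum>j\<in>I. axis i 1 $ j / block_fst z $ j) + block_snd z \<bullet> c' (block_fst z) (axis i 1))
      (c (block_fst z, \<theta>))" for z :: "real^('n + 'k)"
  define dPhi where "dPhi h = block_vec (\<chi> i. ?H (block_fst h) (axis i 1) + block_snd h \<bullet> c' x (axis i 1))
      (c' x (block_fst h))" for h :: "real^('n + 'k)"
  have xU: "x \<in> positive_orthant I" using x by (simp add: feasible_interior_eq)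
  have fst_d: "(block_fst has_derivative block_fst) (at ?z)"
    by (rule bounded_linear_imp_has_derivative[OF bounded_linear_block_fst])
  have snd_d: "(block_snd has_derivative block_snd) (at ?z)"
    by (rule bounded_linear_imp_has_derivative[OF bounded_linear_block_snd])
  have "(Phi has_derivative dPhi) (at ?z)"
  proof (rule has_derivative_vec_nthI)
    fix s :: "'n + 'k"
    show "((\<lambda>z. Phi z $ s) has_derivative (\<lambda>h. dPhi h $ s)) (at ?z)"
    proof (cases s)
      case (Inl i)
      have F: "((\<lambda>z. f' (block_fst z)) has_derivative (\<lambda>h. f'' (block_fst h))) (at ?z)"
        using has_derivative_compose[OF fst_d, of f' "blinfun_apply f''"] ddf by simp
      have C: "((\<lambda>z. c' (block_fst z)) has_derivative (\<lambda>h. c'' (block_fst h))) (at ?z)"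
        using has_derivative_compose[OF fst_d, of c' "blinfun_apply c''"] ddc by simp
      have S: "((\<lambda>z. \<Sum>j\<in>I. axis i 1 $ j / block_fst z $ j) has_derivative
          (\<lambda>h. - (\<Sum>j\<in>I. block_fst h $ j * axis i 1 $ j / (x $ j)\<^sup>2))) (at ?z)"
        using has_derivative_compose[OF fst_d, of "\<lambda>y. \<Sum>j\<in>I. axis i 1 $ j / y $ j"]
          barrier_log_second_derivative[OF xU, of "axis i 1"] by simp
      have "((\<lambda>z. f' (block_fst z) (axis i 1)
          - \<mu> * (\<Sum>j\<in>I. axis i 1 $ j / block_fst z $ j) + block_snd z \<bullet> c' (block_fst z) (axis i 1))
          has_derivative (\<lambda>h. f'' (block_fst h) (axis i 1)
          - \<mu> * (- (\<Sum>j\<in>I. block_fst h $ j * axis i 1 $ j / (x $ j)\<^sup>2))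
          + (lam \<bullet> c'' (block_fst h) (axis i 1) + block_snd h \<bullet> c' x (axis i 1)))) (at ?z)"
        using has_derivative_add[OF has_derivative_diff[OF
              bounded_linear.has_derivative[OF blinfun.bounded_linear_left F]
              has_derivative_mult_right[OF S]]
            has_derivative_inner[OF snd_d bounded_linear.has_derivative[OF blinfun.bounded_linear_left C]]]
        by simp
      then show ?thesis
        unfolding Inl Phi_def dPhi_def barrier_hessian_def
        by (auto elim!: has_derivative_eq_rhs)
    next
      case (Inr j)
      have "((\<lambda>z. c (block_fst z, \<theta>)) has_derivative (\<lambda>h. c' x (block_fst h))) (at ?z)"
        using has_derivative_compose[OF fst_d, of "\<lambda>x. c (x, \<theta>)" "blinfun_apply (c' x)"] dc by simp
      then have "((\<lambda>z. c (block_fst z, \<theta>) $ j) has_derivative (\<lambda>h. c' x (block_fst h) $ j)) (at ?z)"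
        by (rule bounded_linear.has_derivative[OF bounded_linear_vec_nth])
      then show ?thesis unfolding Inr Phi_def dPhi_def by simp
    qed
  qed
  then have dres: "((\<lambda>z. residual I f c \<mu> (block_fst z) (block_snd z) \<theta>) has_derivative dPhi) (at ?z)"
  proof (rule has_derivative_transform_within_open)
    show "open (block_fst -` positive_orthant I :: (real^('n + 'k)) set)"
      by (intro open_vimage open_positive_orthant linear_continuous_on bounded_linear_block_fst)
    show "?z \<in> block_fst -` positive_orthant I" using xU by simp
    show "Phi z = residual I f c \<mu> (block_fst z) (block_snd z) \<theta>"
      if "z \<in> block_fst -` positive_orthant I" for z :: "real^('n + 'k)"
      unfolding Phi_def residual_def
      using that gradient_lagrangian[where f = f and c = c and \<theta> = \<theta> and y = "block_fst z", OF df dc] by (intro arg_cong2[of _ _ _ _ block_vec]) (simp_all add: vec_eq_iff)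
  qed
  have jac: "residual_jacobian I f c \<mu> x lam \<theta> *v h = dPhi h" for h
    using has_derivative_unique[OF dres jacobian_works[THEN iffD1, OF differentiableI[OF dres]]]
    by (simp add: residual_jacobian_def fun_eq_iff)
  have inv: "invertible (residual_jacobian I f c \<mu> x lam \<theta>)"
    using nonsing x by (simp add: singular_point_def)
  show ?thesis
    unfolding kkt_nondegenerate_def
  proof (intro allI impI)
    fix v w assume "c' x v = 0" and "\<forall>z. ?H v z + w \<bullet> c' x z = 0"
    then have "(\<chi> i. ?H v (axis i 1) + w \<bullet> c' x (axis i 1)) = 0"
      by (simp add: vec_eq_iff)
    then have "dPhi (block_vec v w) = 0"
      using \<open>c' x v = 0\<close> by (simp add: dPhi_def)
    then have "block_vec v w = 0"
      using inv jac unfolding invertible_left_inverse matrix_left_invertible_ker by metis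
    then show "v = 0 \<and> w = 0" by simp
  qed
qed

section \<open>Uniqueness and global optimality\<close>

text \<open>
  Otherwise a large negative multiple of \<open>b\<close> makes the expression negative.
\<close>

lemma positive_affine_imp_zero_slope:
  fixes b :: "'b::real_inner"
  assumes "\<And>w. 0 < a + w \<bullet> b"
  shows "b = 0"
proof (rule ccontr)
  assume "b \<noteq> 0"
  then have "b \<bullet> b > 0" by simp
  then show False
    using assms[of "(- (\<bar>a\<bar> + 1) / (b \<bullet> b)) *\<^sub>R b"] by simp
qed

text \<open>
  At \<open>\<theta> = 0\<close> the constraints contribute no curvature and \<open>f\<close> is convex, so the Hessian is
  semidefinite and, by nondegeneracy, definite on the kernel. The connected set along which this is
  transported consists of the feasible pairs \<open>(x, \<theta>)\<close> together with all multipliers. Multipliers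
  are free: path stability covers points that do not solve the first-order system.
\<close>

lemma path_stable_imp_pos_on_kernel:
  fixes f :: "(real^'n) \<times> real \<Rightarrow> real" and c :: "(real^'n) \<times> real \<Rightarrow> real^'k"
  assumes cont: "continuous_on (UNIV \<times> {0..1}) c" "continuous_on (UNIV \<times> {0..1}) c'"
      "continuous_on (UNIV \<times> {0..1}) f''" "continuous_on (UNIV \<times> {0..1}) c''"
    and df: "\<And>x t. t \<in> {0..1} \<Longrightarrow> ((\<lambda>x. f (x, t)) has_derivative blinfun_apply (f' (x, t))) (at x)"
    and ddf: "\<And>x t. t \<in> {0..1} \<Longrightarrow> ((\<lambda>x. f' (x, t)) has_derivative blinfun_apply (f'' (x, t))) (at x)"
    and dc: "\<And>x t. t \<in> {0..1} \<Longrightarrow> ((\<lambda>x. c (x, t)) has_derivative blinfun_apply (c' (x, t))) (at x)"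
    and ddc: "\<And>x t. t \<in> {0..1} \<Longrightarrow> ((\<lambda>x. c' (x, t)) has_derivative blinfun_apply (c'' (x, t))) (at x)"
    and zc: "zero_convex f c" and stable: "path_stable I f c"
    and feas: "\<forall>\<tau>\<in>{0..1}. nonempty_path_connected (feasible_interior I c \<tau>)"
    and "\<mu> > 0" and \<theta>: "\<theta> \<in> {0..1}" and x: "x \<in> feasible_interior I c \<theta>"
  shows "pos_on_kernel (barrier_hessian I \<mu> (f'' (x, \<theta>)) (c'' (x, \<theta>)) lam x) (c' (x, \<theta>))"
    and "surj (blinfun_apply (c' (x, \<theta>)))"
proof -
  define S where "S = {p \<in> positive_orthant I \<times> {0..1}. c p = 0}"
  define H where "H = (\<lambda>(p, lam). barrier_hessian I \<mu> (f'' p) (c'' p) lam (fst p))"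
  define A where "A = (\<lambda>(p, lam :: real^'k). c' p)"
  have S_iff: "(x, t) \<in> S \<longleftrightarrow> t \<in> {0..1} \<and> x \<in> feasible_interior I c t" for x t
    by (auto simp: S_def feasible_interior_eq)
  have nondeg: "kkt_nondegenerate (barrier_hessian I \<mu> (f'' (x, t)) (c'' (x, t)) lam x) (c' (x, t))"
    if "t \<in> {0..1}" "x \<in> feasible_interior I c t" for x t lam
  proof (rule nonsingular_imp_kkt_nondegenerate[where f = f and c = c and \<theta> = t
        and f' = "\<lambda>x. f' (x, t)" and c' = "\<lambda>x. c' (x, t)"])
    show "\<not> singular_point I f c \<mu> t x lam"
      using stable \<open>\<mu> > 0\<close> that by (auto simp: path_stable_def)
  qed (use that df ddf dc ddc in auto)
  have surj: "surj (blinfun_apply (c' (x, t)))" if "t \<in> {0..1}" "x \<in> feasible_interior I c t" for x t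
    using kkt_nondegenerate_imp_surj[OF bilinear_barrier_hessian nondeg[OF that]] .
  have sym: "barrier_hessian I \<mu> (f'' (x, t)) (c'' (x, t)) lam x u v =
      barrier_hessian I \<mu> (f'' (x, t)) (c'' (x, t)) lam x v u" if t: "t \<in> {0..1}" for x t lam u v
  proof -
    have "f'' (x, t) u v = f'' (x, t) v u"
      by (rule second_derivative_symmetric[where g = "\<lambda>x. f (x, t)" and g'' = "\<lambda>u v. f'' (x, t) u v",
            OF df[OF t] bounded_linear.has_derivative[OF blinfun.bounded_linear_left ddf[OF t]]])
    moreover have "lam \<bullet> c'' (x, t) u v = lam \<bullet> c'' (x, t) v u"
      by (rule second_derivative_symmetric[where g = "\<lambda>x. lam \<bullet> c (x, t)" and g'' = "\<lambda>u v. lam \<bullet> c'' (x, t) u v",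
            OF has_derivative_inner_right[OF dc[OF t]]
            has_derivative_inner_right[OF bounded_linear.has_derivative[OF blinfun.bounded_linear_left ddc[OF t]]]])
    ultimately show ?thesis by (simp add: barrier_hessian_def mult.commute)
  qed
  have "connected S"
    unfolding S_def
  proof (rule connected_family_of_zero_sets[where c' = c', OF cont(1)])
    fix t :: real assume t: "t \<in> {0..1}"
    show "{x \<in> positive_orthant I. c (x, t) = 0} \<noteq> {}"
      "connected {x \<in> positive_orthant I. c (x, t) = 0}"
      using feas t unfolding nonempty_path_connected_def feasible_interior_eq[symmetric]
      by (auto intro: path_connected_imp_connected)
  qed (use dc surj in \<open>auto simp: open_positive_orthant feasible_interior_eq\<close>)
  then have conn: "connected (S \<times> (UNIV :: (real^'k) set))"
    by (simp add: connected_Times convex_connected[OF convex_UNIV])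
  have contA: "continuous_on (S \<times> UNIV) A"
    unfolding A_def case_prod_unfold
    by (rule continuous_on_compose2[OF cont(2)]) (auto simp: S_def intro!: continuous_intros)
  have contH: "continuous_on ((S \<times> UNIV) \<times> UNIV) (\<lambda>(q, v). H q v v)"
  proof -
    have "continuous_on ((S \<times> UNIV) \<times> (UNIV :: (real^'n) set)) (\<lambda>z. f'' (fst (fst z)))"
      "continuous_on ((S \<times> (UNIV :: (real^'k) set)) \<times> (UNIV :: (real^'n) set)) (\<lambda>z. c'' (fst (fst z)))"
      by (rule continuous_on_compose2[OF cont(3)] continuous_on_compose2[OF cont(4)];
          auto simp: S_def intro!: continuous_intros)+
    then show ?thesis
      unfolding H_def barrier_hessian_def case_prod_unfold
      by (intro continuous_intros) (auto simp: S_def positive_orthant_def)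
  qed
  obtain x0 where x0: "x0 \<in> feasible_interior I c 0"
    using feas by (force simp: nonempty_path_connected_def)
  have flat0: "c'' (x0, 0) = 0"
  proof -
    obtain B :: "real^'n^'k" and b where B: "\<And>x. c (x, 0) = B *v x + b"
      using zc unfolding zero_convex_def by blast
    have "((\<lambda>x. c (x, 0)) has_derivative (\<lambda>h. B *v h)) (at x)" for x
      unfolding B using has_derivative_add_const[OF bounded_linear_imp_has_derivative[OF matrix_vector_mul_bounded_linear]] .
    then have "blinfun_apply (c' (x, 0)) = (\<lambda>h. B *v h)" for x
      by (intro has_derivative_unique[OF dc]) auto
    then have const: "c' (x, 0) = c' (x0, 0)" for x
      by (intro blinfun_eqI) simp
    have "((\<lambda>x. c' (x, 0)) has_derivative (\<lambda>h. 0)) (at x0)"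
      by (subst const) simp
    then have "blinfun_apply (c'' (x0, 0)) = (\<lambda>h. 0)"
      by (intro has_derivative_unique[OF ddc]) auto
    then show ?thesis by (intro blinfun_eqI) simp
  qed
  have "pos_on_kernel (barrier_hessian I \<mu> (f'' (x0, 0)) (c'' (x0, 0)) lam x0) (c' (x0, 0))"
  proof (rule semidefinite_nondegenerate_imp_pos_on_kernel[OF bilinear_barrier_hessian sym])
    fix v
    have "0 \<le> f'' (x0, 0) v v"
    proof (rule convex_imp_second_derivative_nonneg[where g = "\<lambda>x. f (x, 0)" and g'' = "\<lambda>u v. f'' (x0, 0) u v"])
      show "convex_on UNIV (\<lambda>x. f (x, 0))" using zc by (simp add: zero_convex_def)
      show "((\<lambda>x. f (x, 0)) has_derivative blinfun_apply (f' (x, 0))) (at x)" for x using df by simp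
      show "((\<lambda>x. f' (x, 0) v) has_derivative (\<lambda>h. f'' (x0, 0) h v)) (at x0)"
        using bounded_linear.has_derivative[OF blinfun.bounded_linear_left ddf[of 0]] by simp
    qed
    moreover have "0 \<le> (\<Sum>i\<in>I. v $ i * v $ i / (x0 $ i)\<^sup>2)" by (intro sum_nonneg) auto
    ultimately show "0 \<le> barrier_hessian I \<mu> (f'' (x0, 0)) (c'' (x0, 0)) lam x0 v v"
      using \<open>\<mu> > 0\<close> by (simp add: barrier_hessian_def flat0)
  qed (use nondeg x0 in auto)
  then have start: "pos_on_kernel (H ((x0, 0), lam)) (A ((x0, 0), lam))" by (simp add: H_def A_def)
  have "pos_on_kernel (H ((x, \<theta>), lam)) (A ((x, \<theta>), lam))"
  proof (rule pos_on_kernel_propagates[where H = H and A = A, OF conn contA contH _ _ _ _ _ start])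
    show "bilinear (H p)" for p
      by (simp add: H_def case_prod_unfold bilinear_barrier_hessian)
    show "H p u v = H p v u" if "p \<in> S \<times> UNIV" for p u v
      using that sym by (auto simp: H_def S_def)
    show "kkt_nondegenerate (H p) (A p)" if "p \<in> S \<times> UNIV" for p
      using that nondeg by (auto simp: H_def A_def S_iff)
  qed (use x x0 \<theta> in \<open>auto simp: S_iff\<close>)
  then show "pos_on_kernel (barrier_hessian I \<mu> (f'' (x, \<theta>)) (c'' (x, \<theta>)) lam x) (c' (x, \<theta>))"
    by (simp add: H_def A_def)
  show "surj (blinfun_apply (c' (x, \<theta>)))" using surj[OF \<theta> x] .
qed

theorem theorem3p7:
  fixes f :: "(real^'n) \<times> real \<Rightarrow> real"
    and c :: "(real^'n) \<times> real \<Rightarrow> real^'k"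
    and I :: "'n set"
    and \<mu> \<theta> :: real
  assumes "C2_on (UNIV \<times> {0..1}) f"
    and "C2_on (UNIV \<times> {0..1}) c"
    and "zero_convex f c"
    and "path_stable I f c"
    and "\<forall>\<tau>\<in>{0..1}. nonempty_path_connected (feasible_interior I c \<tau>)"
    and "\<mu> > 0"
    and "\<theta> \<in> {0..1}"
  shows "(\<forall>x lam x' lam'. barrier_solution I f c \<mu> \<theta> x lam \<and> barrier_solution I f c \<mu> \<theta> x' lam'
            \<longrightarrow> x = x' \<and> lam = lam') \<and>
         (\<forall>x lam. barrier_solution I f c \<mu> \<theta> x lam
            \<longrightarrow> (\<forall>y. barrier_global_optimum I f c \<mu> \<theta> y \<longleftrightarrow> y = x))"
proof -
  note \<theta> = \<open>\<theta> \<in> {0..1}\<close>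
  obtain f' f'' where cf: "continuous_on (UNIV \<times> {0..1}) f''"
    and df: "\<And>x t. t \<in> {0..1} \<Longrightarrow> ((\<lambda>x. f (x, t)) has_derivative blinfun_apply (f' (x, t))) (at x)"
    and ddf: "\<And>x t. t \<in> {0..1} \<Longrightarrow> ((\<lambda>x. f' (x, t)) has_derivative blinfun_apply (f'' (x, t))) (at x)"
    using C2_on_sections[OF assms(1)] by metis
  obtain c' c'' where cc: "continuous_on (UNIV \<times> {0..1}) c"
      "continuous_on (UNIV \<times> {0..1}) c'" "continuous_on (UNIV \<times> {0..1}) c''"
    and dc: "\<And>x t. t \<in> {0..1} \<Longrightarrow> ((\<lambda>x. c (x, t)) has_derivative blinfun_apply (c' (x, t))) (at x)"
    and ddc: "\<And>x t. t \<in> {0..1} \<Longrightarrow> ((\<lambda>x. c' (x, t)) has_derivative blinfun_apply (c'' (x, t))) (at x)"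
    using C2_on_sections[OF assms(2)] by metis
  let ?U = "positive_orthant I"
  define M where "M = feasible_interior I c \<theta>"
  define H where "H = (\<lambda>x lam. barrier_hessian I \<mu> (f'' (x, \<theta>)) (c'' (x, \<theta>)) lam x)"
  have M_eq: "M = {x \<in> ?U. c (x, \<theta>) = 0}" by (simp add: M_def feasible_interior_eq)
  have pos: "0 < H x lam v v" if "x \<in> M" "c' (x, \<theta>) v = 0" "v \<noteq> 0" for x lam v
    using path_stable_imp_pos_on_kernel(1)[where f = f and c = c,
        OF cc(1,2) cf cc(3) df ddf dc ddc assms(3,4,5,6) \<theta>, of x lam] that
    unfolding pos_on_kernel_def H_def M_def by blast
  have surj: "surj (blinfun_apply (c' (x, \<theta>)))" if "x \<in> M" for x
    using path_stable_imp_pos_on_kernel(2)[where f = f and c = c,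
        OF cc(1,2) cf cc(3) df ddf dc ddc assms(3,4,5,6) \<theta>, of x] that
    unfolding M_def by blast
  \<comment> \<open>positivity for all multipliers at once forces the curvature of the constraints to vanish\<close>
  have flat: "c'' (x, \<theta>) v v = 0" if "x \<in> M" "c' (x, \<theta>) v = 0" for x v
  proof (cases "v = 0")
    case False
    show ?thesis
    proof (rule positive_affine_imp_zero_slope)
      show "0 < H x 0 v v + w \<bullet> c'' (x, \<theta>) v v" for w
        using pos[OF that False, of w] by (simp add: H_def barrier_hessian_def)
    qed
  qed (simp add: blinfun.zero_right)
  have "convex M"
  proof (rule locally_affine_imp_convex[OF _ convex_positive_orthant])
    show "connected M"
      using assms(5) \<theta> unfolding nonempty_path_connected_def M_def
      by (auto intro: path_connected_imp_connected)
    have cont: "continuous_on ?U (\<lambda>x. c (x, \<theta>))"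
      using dc[OF \<theta>] by (meson continuous_at_imp_continuous_on has_derivative_continuous)
    have "M = ?U \<inter> (\<lambda>x. c (x, \<theta>)) -` {0}" by (auto simp: M_eq)
    then show "closedin (top_of_set ?U) M"
      using continuous_closedin_preimage[OF cont closed_singleton] by simp
    fix x assume x: "x \<in> M"
    then have xU: "x \<in> ?U" "c (x, \<theta>) = 0" by (auto simp: M_eq)
    have cont'': "continuous_on ?U (\<lambda>x. c'' (x, \<theta>))"
      by (rule continuous_on_compose2[OF cc(3)]) (use \<theta> in \<open>auto intro!: continuous_intros\<close>)
    obtain r where r: "r > 0" "ball x r \<subseteq> ?U" "\<And>y. y \<in> ball x r \<Longrightarrow> c (y, \<theta>) = 0 \<longleftrightarrow> c' (x, \<theta>) (y - x) = 0"
      using level_set_locally_affine[where c = "\<lambda>x. c (x, \<theta>)" and c' = "\<lambda>x. c' (x, \<theta>)" and c'' = "\<lambda>x. c'' (x, \<theta>)",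
          OF open_positive_orthant dc[OF \<theta>] ddc[OF \<theta>] cont'' _ xU surj[OF x]] flat
      by (auto simp: M_eq)
    show "\<exists>K r. subspace K \<and> 0 < r \<and> ball x r \<subseteq> ?U \<and> (\<forall>y\<in>ball x r. y \<in> M \<longleftrightarrow> y - x \<in> K)"
    proof (intro exI conjI ballI)
      show "subspace {v. c' (x, \<theta>) v = 0}"
        by (simp add: subspace_def blinfun.bilinear_simps blinfun.zero_right)
      show "y \<in> M \<longleftrightarrow> y - x \<in> {v. c' (x, \<theta>) v = 0}" if "y \<in> ball x r" for y
        using r(2,3) that by (auto simp: M_eq)
    qed (use r in auto)
  qed
  have tangent: "c' (z, \<theta>) (y - z) = 0" if "z \<in> M" "y \<in> M" for y z
    using derivative_zero_along_segment[OF dc[OF \<theta>]] closed_segment_subset[OF that \<open>convex M\<close>]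
    by (auto simp: M_eq)
  have stationary: "f' (x, \<theta>) h - \<mu> * (\<Sum>i\<in>I. h $ i / x $ i) + lam \<bullet> c' (x, \<theta>) h = 0"
    if sol: "barrier_solution I f c \<mu> \<theta> x lam" for x lam h
  proof -
    have x: "x \<in> ?U" using sol by (simp add: barrier_solution_def feasible_interior_eq)
    let ?D = "\<lambda>h. f' (x, \<theta>) h - \<mu> * (\<Sum>i\<in>I. h $ i / x $ i) + lam \<bullet> c' (x, \<theta>) h"
    have lin: "linear ?D"
      by (rule has_derivative_linear[OF lagrangian_derivative[where f = f and c = c, OF df[OF \<theta>] dc[OF \<theta>] x]])
    have "gradient (\<lambda>y. lagrangian I f c \<mu> y lam \<theta>) x = 0"
      using sol by (simp add: barrier_solution_def residual_def)
    then have "?D (axis i 1) = 0" for i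
      using gradient_lagrangian[where f = f and c = c, OF df[OF \<theta>] dc[OF \<theta>] x] by (metis zero_index)
    moreover have "?D (\<Sum>i\<in>UNIV. (h $ i) *\<^sub>R axis i 1) = (\<Sum>i\<in>UNIV. (h $ i) * ?D (axis i 1))"
      unfolding linear_sum[OF lin] linear_cmul[OF lin] by simp
    ultimately show ?thesis
      by (simp add: basis_expansion scalar_mult_eq_scaleR[symmetric])
  qed
  have less: "barrier_objective I f \<mu> \<theta> x < barrier_objective I f \<mu> \<theta> y"
    if sol: "barrier_solution I f c \<mu> \<theta> x lam" and y: "y \<in> M" "y \<noteq> x" for x lam y
  proof (rule strict_minimum_on_segment[where phi = "barrier_objective I f \<mu> \<theta>" and M = M])
    have x: "x \<in> M" using sol by (simp add: barrier_solution_def M_def)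
    let ?d1 = "\<lambda>z h. f' (z, \<theta>) h - \<mu> * (\<Sum>i\<in>I. h $ i / z $ i)"
    let ?d2 = "\<lambda>z u v. f'' (z, \<theta>) u v + \<mu> * (\<Sum>i\<in>I. u $ i * v $ i / (z $ i)\<^sup>2)"
    show seg: "closed_segment x y \<subseteq> M" using closed_segment_subset[OF x y(1) \<open>convex M\<close>] .
    show "x \<noteq> y" using y by simp
    show "(barrier_objective I f \<mu> \<theta> has_derivative ?d1 z) (at z)" if "z \<in> M" for z
      unfolding barrier_objective_def using that
      by (intro derivative_intros df \<theta> barrier_log_derivative) (simp add: M_eq)
    show "((\<lambda>z. ?d1 z (y - x)) has_derivative (\<lambda>h. ?d2 z h (y - x))) (at z)" if "z \<in> M" for z
    proof -
      have "z \<in> ?U" using that by (simp add: M_eq)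
      then have "((\<lambda>z. \<Sum>i\<in>I. (y - x) $ i / z $ i) has_derivative
          (\<lambda>h. - (\<Sum>i\<in>I. h $ i * (y - x) $ i / (z $ i)\<^sup>2))) (at z)"
        by (rule barrier_log_second_derivative)
      from has_derivative_diff[OF bounded_linear.has_derivative[OF blinfun.bounded_linear_left ddf[OF \<theta>, of z]]
          has_derivative_mult_right[OF this, of \<mu>]]
      show ?thesis by simp
    qed
    show "?d1 x (y - x) = 0" using stationary[OF sol, of "y - x"] tangent[OF x y(1)] by simp
    show "0 < ?d2 z (y - x) (y - x)" if z: "z \<in> closed_segment x y" for z
    proof -
      have zM: "z \<in> M" using seg z by blast
      \<comment> \<open>\<open>y - x\<close> is tangent at \<open>z\<close>, as both end points are feasible\<close>
      have "c' (z, \<theta>) ((y - z) - (x - z)) = 0"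
        using tangent[OF zM y(1)] tangent[OF zM x] by (simp only: blinfun.diff_right) simp
      then have "c' (z, \<theta>) (y - x) = 0" by simp
      then show ?thesis using pos[OF zM, of "y - x" 0] y(2) by (simp add: H_def barrier_hessian_def)
    qed
  qed
  have sol_M: "x \<in> M" if "barrier_solution I f c \<mu> \<theta> x lam" for x lam
    using that by (simp add: barrier_solution_def M_def)
  have unique_x: "x = x'" if "barrier_solution I f c \<mu> \<theta> x lam" "barrier_solution I f c \<mu> \<theta> x' lam'" for x lam x' lam'
    using less[OF that(1) sol_M[OF that(2)]] less[OF that(2) sol_M[OF that(1)]] by fastforce
  have unique_lam: "lam = lam'" if "barrier_solution I f c \<mu> \<theta> x lam" "barrier_solution I f c \<mu> \<theta> x lam'" for x lam lam'
  proof -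
    have "(lam - lam') \<bullet> c' (x, \<theta>) h = 0" for h
      using stationary[OF that(1), of h] stationary[OF that(2), of h] by (simp add: inner_diff_left)
    then have "(lam - lam') \<bullet> (lam - lam') = 0"
      using surj[OF sol_M[OF that(1)]] by (metis surjD)
    then show ?thesis by simp
  qed
  have "barrier_global_optimum I f c \<mu> \<theta> y \<longleftrightarrow> y = x" if "barrier_solution I f c \<mu> \<theta> x lam" for x lam y
    using less[OF that] sol_M[OF that]
    unfolding barrier_global_optimum_def is_arg_min_def M_def[symmetric] by (metis order_less_asym)
  then show ?thesis using unique_x unique_lam by blast
qed

end
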